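(* For the last-passage model with random exponential distributions described in the context, as $\alpha\searrow0$, $$\Psi_G(\alpha,1)=\mu_G+2\sigma_G\sqrt\alpha+O(\alpha).$$
   Context: Let $c>0$ and let $\{\xi_j\}_{j\in\mathbb Z_+}$ be i.i.d. random variables with $\xi_j\ge c$ and common distribution $m$, where $c$ is the exact lower bound: $m[c,c+\varepsilon)>0$ for each $\varepsilon>0$. Let $G_j(x)=1-e^{-\xi_jx}$, $x>0$, be the exponential distribution with rate $\xi_j$. Given $\{\xi_j\}$, the weights $\{X(i,j):(i,j)\in\mathbb Z_+^2\}$ are independent with $X(i,j)\sim G_j$. $T(k,\ell)$ is the maximum of $\sum_{z\in\pi}X(z)$ over all nearest-neighbor lattice paths $\pi$ from $(0,0)$ to $(k,\ell)$ with steps $(1,0)$ or $(0,1)$, the endpoint $(k,\ell)$ excluded. $\Psi_G(x,y)=\lim_{n\to\infty}\frac1nT(\lfloor nx\rfloor,\lfloor ny\rfloor)$ for $(x,y)\in(0,\infty)^2$ is the almost sure deterministic limit. $\mu_G=\int_{[c,\infty)}\xi^{-1}\,m(d\xi)$, $\sigma_G^2=\int_{[c,\infty)}\xi^{-2}\,m(d\xi)$, $\sigma_G=\sqrt{\sigma_G^2}$. *)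

theory Defs
  imports "HOL-Probability.Probability" "HOL-Library.Landau_Symbols"
begin

definition lattice_step :: "nat \<times> nat \<Rightarrow> nat \<times> nat \<Rightarrow> bool" where
  "lattice_step u v \<longleftrightarrow> v = (fst u + 1, snd u) \<or> v = (fst u, snd u + 1)"

definition lattice_paths :: "nat \<times> nat \<Rightarrow> nat \<times> nat \<Rightarrow> (nat \<times> nat) list set" where
  "lattice_paths u v =
     {\<pi>. \<pi> \<noteq> [] \<and> hd \<pi> = u \<and> last \<pi> = v \<and> successively lattice_step \<pi>}"

(* The weight of the endpoint is not counted, so the sum runs over butlast. *)
definition last_passage :: "(nat \<times> nat \<Rightarrow> real) \<Rightarrow> nat \<Rightarrow> nat \<Rightarrow> real" where
  "last_passage X k l =
     Max ((\<lambda>\<pi>. \<Sum>z\<leftarrow>butlast \<pi>. X z) ` lattice_paths (0, 0) (k, l))"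

lemma lattice_path_bounds:
  assumes "\<pi> \<noteq> []" "successively lattice_step \<pi>"
  shows "length \<pi> + fst (hd \<pi>) + snd (hd \<pi>) = Suc (fst (last \<pi>) + snd (last \<pi>))
    \<and> (\<forall>z\<in>set \<pi>. fst z \<le> fst (last \<pi>) \<and> snd z \<le> snd (last \<pi>))"
  using assms
proof (induction \<pi>)
  case (Cons a \<pi>)
  show ?case
  proof (cases \<pi>)
    case (Cons b \<pi>')
    then show ?thesis using Cons.IH Cons.prems by (auto simp: lattice_step_def)
  qed simp
qed simp

lemma finite_lattice_paths: "finite (lattice_paths u v)"
proof (rule finite_subset)
  show "lattice_paths u v \<subseteq>
      {\<pi>. set \<pi> \<subseteq> {..fst v} \<times> {..snd v} \<and> length \<pi> \<le> Suc (fst v + snd v)}"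
    using lattice_path_bounds by (fastforce simp: lattice_paths_def)
qed (rule finite_lists_length_le, simp)

lemma lattice_paths_nonempty: "lattice_paths (0, 0) (k, l) \<noteq> {}"
proof -
  have row: "\<exists>\<pi>. \<pi> \<in> lattice_paths (0, 0) (k, 0)" for k
  proof (induction k)
    case 0
    have "[(0, 0)] \<in> lattice_paths (0, 0) (0, 0)" by (simp add: lattice_paths_def)
    then show ?case ..
  next
    case (Suc k)
    then obtain \<pi> where "\<pi> \<in> lattice_paths (0, 0) (k, 0)" ..
    then have "\<pi> @ [(Suc k, 0)] \<in> lattice_paths (0, 0) (Suc k, 0)"
      by (auto simp: lattice_paths_def lattice_step_def successively_append_iff)
    then show ?case ..
  qed
  have "\<exists>\<pi>. \<pi> \<in> lattice_paths (0, 0) (k, l)"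
  proof (induction l)
    case 0
    show ?case by (rule row)
  next
    case (Suc l)
    then obtain \<pi> where "\<pi> \<in> lattice_paths (0, 0) (k, l)" ..
    then have "\<pi> @ [(k, Suc l)] \<in> lattice_paths (0, 0) (k, Suc l)"
      by (auto simp: lattice_paths_def lattice_step_def successively_append_iff)
    then show ?case ..
  qed
  then show ?thesis by blast
qed

(* The sigma-algebra generated by the whole sequence of rates. *)
definition env_algebra :: "'a measure \<Rightarrow> (nat \<Rightarrow> 'a \<Rightarrow> real) \<Rightarrow> 'a measure" where
  "env_algebra M \<xi> = vimage_algebra (space M) (\<lambda>w j. \<xi> j w) (Pi\<^sub>M UNIV (\<lambda>_. borel))"

definition cond_prob_given :: "'a measure \<Rightarrow> 'a measure \<Rightarrow> 'a set \<Rightarrow> 'a \<Rightarrow> real" where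
  "cond_prob_given M F A = real_cond_exp M F (indicator A)"

definition cond_indep_family ::
    "'a measure \<Rightarrow> 'a measure \<Rightarrow> ('i \<Rightarrow> 'a \<Rightarrow> real) \<Rightarrow> bool" where
  "cond_indep_family M F X \<longleftrightarrow>
     (\<forall>J B. finite J \<longrightarrow> J \<noteq> {} \<longrightarrow> (\<forall>z\<in>J. B z \<in> sets borel) \<longrightarrow>
        (AE w in M. cond_prob_given M F {w \<in> space M. \<forall>z\<in>J. X z w \<in> B z} w
           = (\<Prod>z\<in>J. cond_prob_given M F {w \<in> space M. X z w \<in> B z} w)))"

(* Distribution function of the exponential law of rate r, for arguments x > 0. *)
definition exp_cdf :: "real \<Rightarrow> real \<Rightarrow> real" where
  "exp_cdf r x = 1 - exp (- r * x)"

(* Given the rates, the weights are independent and X (i, j) is exponential with rate \<xi> j;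
   the rate is indexed by the second coordinate. *)
definition exp_weights_given ::
    "'a measure \<Rightarrow> (nat \<Rightarrow> 'a \<Rightarrow> real) \<Rightarrow> (nat \<times> nat \<Rightarrow> 'a \<Rightarrow> real) \<Rightarrow> bool" where
  "exp_weights_given M \<xi> X \<longleftrightarrow>
     (\<forall>z. X z \<in> borel_measurable M) \<and>
     cond_indep_family M (env_algebra M \<xi>) X \<and>
     (\<forall>i j. \<forall>x>0. AE w in M.
        cond_prob_given M (env_algebra M \<xi>) {w \<in> space M. X (i, j) w \<le> x} w
          = exp_cdf (\<xi> j w) x)"

definition is_limit_shape ::
    "'a measure \<Rightarrow> (nat \<times> nat \<Rightarrow> 'a \<Rightarrow> real) \<Rightarrow> (real \<Rightarrow> real \<Rightarrow> real) \<Rightarrow> bool" where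
  "is_limit_shape M X \<Psi> \<longleftrightarrow>
     (\<forall>x>0. \<forall>y>0. AE w in M.
        (\<lambda>n. last_passage (\<lambda>z. X z w) (nat \<lfloor>real n * x\<rfloor>) (nat \<lfloor>real n * y\<rfloor>) / real n)
          \<longlonglongrightarrow> \<Psi> x y)"

definition mu_G :: "real \<Rightarrow> real measure \<Rightarrow> real" where
  "mu_G c m = (LINT r:{c..}|m. 1 / r)"

(* The second moment of 1 / r, not its variance. *)
definition sigma_G :: "real \<Rightarrow> real measure \<Rightarrow> real" where
  "sigma_G c m = sqrt (LINT r:{c..}|m. 1 / r\<^sup>2)"

end

(* The limit shape has the variational upper bound Psi(alpha,1) <= phi(z) := alpha/z + E[1/(xi - z)]
   for every z in (0,c): put extra weights on the two axes, exponential of rate z on the horizontal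
   one and of rate xi_j - z on the vertical one. By the Burke property the increments of the enlarged
   last-passage time along the horizontal axis, and those along the opposite vertical side, are
   independent exponentials again, so a law of large numbers gives its growth rate phi(z).

   If alpha = z^2 E[(xi - z)^(-2)], that is phi'(z) = 0, the bound is attained. A maximal path of the
   enlarged model that follows the horizontal axis for delta n steps would gain linearly when z is
   lowered to z1, but phi(z1) - phi(z) is only quadratic in z1 - z; similarly for the vertical axis
   and z2 > z. Hence such paths are not maximal, and the axes contribute only O(delta n).

   Finally phi(z) >= mu + alpha/z + z sigma^2 >= mu + 2 sigma sqrt(alpha), while z = sqrt(alpha)/sigma
   gives phi(z) <= mu + 2 sigma sqrt(alpha) + 2 alpha/c. *)
theory Submission imports Defs begin

section \<open>The last-passage recursion\<close>

text \<open>The models with parameters \<open>z1 < z < z2\<close> have to be compared path by path,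
  not only in law. Hence all weights are one family of unit exponentials divided by their rates:
  lowering \<open>z\<close> raises every weight on the horizontal axis, raising \<open>z\<close>
  raises every weight on the vertical one, and the bulk never changes. The given space need not
  carry such a family, so the proof works on its product with an independent one. The hypothesis on
  \<open>X\<close> speaks of conditional probabilities; it determines the joint law of the weights,
  and convergence in probability to a constant depends only on laws. This is the mode of convergence
  used throughout: an almost sure limit passes to the other space in this form, inequalities between
  constants can be read off from it, limits add whatever the joint law of the summands is, and
  second moments with Chebyshev give the law of large numbers. The Burke property therefore enters
  only through the sum of the vertical increments along one column, with the rates frozen.\<close>

fun lpp :: "(nat \<times> nat \<Rightarrow> real) \<Rightarrow> nat \<Rightarrow> nat \<Rightarrow> real" where
  "lpp w 0 0 = 0"
| "lpp w (Suc i) 0 = lpp w i 0 + w (Suc i, 0)"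
| "lpp w 0 (Suc j) = lpp w 0 j + w (0, Suc j)"
| "lpp w (Suc i) (Suc j) = w (Suc i, Suc j) + max (lpp w i (Suc j)) (lpp w (Suc i) j)"

definition hinc :: "(nat \<times> nat \<Rightarrow> real) \<Rightarrow> nat \<Rightarrow> nat \<Rightarrow> real" where
  "hinc w i j = lpp w (Suc i) j - lpp w i j"

definition vinc :: "(nat \<times> nat \<Rightarrow> real) \<Rightarrow> nat \<Rightarrow> nat \<Rightarrow> real" where
  "vinc w i j = lpp w i (Suc j) - lpp w i j"

lemma lpp_row: "lpp w i 0 = (\<Sum>i'<i. w (Suc i', 0))"
  by (induction i) auto

lemma lpp_col: "lpp w 0 j = (\<Sum>j'<j. w (0, Suc j'))"
  by (induction j) auto

lemma hinc_0: "hinc w i 0 = w (Suc i, 0)"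
  by (simp add: hinc_def)

lemma vinc_0: "vinc w 0 j = w (0, Suc j)"
  by (simp add: vinc_def)

text \<open>With \<open>vinc_Suc\<close>: the two increments leaving a cell depend only on the two
  entering it and on its weight. This local map is the one that \<open>flip\<close> applies to a
  product measure.\<close>

lemma hinc_Suc: "hinc w i (Suc j) = w (Suc i, Suc j) + max 0 (hinc w i j - vinc w i j)"
  by (auto simp: hinc_def vinc_def max_def)

lemma vinc_Suc: "vinc w (Suc i) j = w (Suc i, Suc j) + max 0 (vinc w i j - hinc w i j)"
  by (auto simp: hinc_def vinc_def max_def)

lemma lpp_eq_sum_vinc: "lpp w i l - lpp w i 0 = (\<Sum>j<l. vinc w i j)"
  by (induction l) (auto simp: vinc_def)

lemma lpp_mono:
  assumes "\<And>a. w a \<le> w' a"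
  shows "lpp w i j \<le> lpp w' i j"
  using assms
proof (induction w i j rule: lpp.induct)
  case (4 w i j)
  then show ?case by (auto intro!: add_mono max.mono)
qed (auto intro: add_mono)

(* A path that follows the horizontal axis for at least a steps gains the first a differences when
   w is replaced by w1, likewise vertically for b and w2; every other path collects at most the first
   a + b axis weights before it enters the bulk. *)
lemma lpp_exit_split:
  fixes w w0 w1 w2 :: "nat \<times> nat \<Rightarrow> real"
  assumes bulk: "\<And>i j. w1 (Suc i, Suc j) = w (Suc i, Suc j)" "\<And>i j. w2 (Suc i, Suc j) = w (Suc i, Suc j)"
      "\<And>i j. w0 (Suc i, Suc j) = w (Suc i, Suc j)"
    and bd0: "\<And>i. w0 (i, 0) = 0" "\<And>j. w0 (0, j) = 0"
    and bd1: "\<And>i. w (Suc i, 0) \<le> w1 (Suc i, 0)" and bd2: "\<And>j. w (0, Suc j) \<le> w2 (0, Suc j)"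
    and nonneg: "\<And>i. w (i, 0) \<ge> 0" "\<And>j. w (0, j) \<ge> 0"
  shows "lpp w k l \<le> max (lpp w1 k l - (\<Sum>i<a. w1 (Suc i, 0) - w (Suc i, 0)))
     (max (lpp w2 k l - (\<Sum>j<b. w2 (0, Suc j) - w (0, Suc j)))
       ((\<Sum>i<a. w (Suc i, 0)) + (\<Sum>j<b. w (0, Suc j)) + lpp w0 k l))"
proof -
  define D1 where "D1 = (\<Sum>i<a. w1 (Suc i, 0) - w (Suc i, 0))"
  define D2 where "D2 = (\<Sum>j<b. w2 (0, Suc j) - w (0, Suc j))"
  define Ea where "Ea = (\<Sum>i<a. w (Suc i, 0))"
  define Eb where "Eb = (\<Sum>j<b. w (0, Suc j))"
  have pos: "Ea \<ge> 0" "Eb \<ge> 0"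
    unfolding Ea_def Eb_def using nonneg by (auto intro!: sum_nonneg)
  have row: "lpp w i 0 \<le> max (lpp w1 i 0 - D1) (Ea + Eb + lpp w0 i 0)" for i
  proof (cases "i \<ge> a")
    case True
    have "D1 \<le> (\<Sum>i'<i. w1 (Suc i', 0) - w (Suc i', 0))"
      unfolding D1_def using True bd1 by (intro sum_mono2) (auto simp: algebra_simps)
    then show ?thesis by (simp add: lpp_row sum_subtractf)
  next
    case False
    then have "(\<Sum>i'<i. w (Suc i', 0)) \<le> Ea"
      unfolding Ea_def using nonneg by (intro sum_mono2) auto
    then show ?thesis using pos by (simp add: lpp_row bd0)
  qed
  have col: "lpp w 0 j \<le> max (lpp w2 0 j - D2) (Ea + Eb + lpp w0 0 j)" for j
  proof (cases "j \<ge> b")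
    case True
    have "D2 \<le> (\<Sum>j'<j. w2 (0, Suc j') - w (0, Suc j'))"
      unfolding D2_def using True bd2 by (intro sum_mono2) (auto simp: algebra_simps)
    then show ?thesis by (simp add: lpp_col sum_subtractf)
  next
    case False
    then have "(\<Sum>j'<j. w (0, Suc j')) \<le> Eb"
      unfolding Eb_def using nonneg by (intro sum_mono2) auto
    then show ?thesis using pos by (simp add: lpp_col bd0)
  qed
  \<comment> \<open>Each alternative is a last-passage time with the same bulk weights plus a
    constant, and the max-plus recursion commutes with constants and maxima. So only the axes needed
    an argument of their own.\<close>
  have "lpp w i j \<le> max (lpp w1 i j - D1) (max (lpp w2 i j - D2) (Ea + Eb + lpp w0 i j))" for i j
  proof (induction i arbitrary: j)
    case 0
    show ?case using col[of j] by auto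
  next
    case (Suc i)
    note left = Suc.IH
    show ?case
    proof (induction j)
      case 0
      show ?case using row[of "Suc i"] by auto
    next
      case (Suc j)
      then show ?case using left[of "Suc j"] by (auto simp: bulk max_def split: if_splits)
    qed
  qed
  then show ?thesis by (simp add: D1_def D2_def Ea_def Eb_def)
qed

text \<open>The shift by (1, 1) frees a row and a column for the boundary weights of the enlarged
  model; with zeros there, the original model obeys the same recursion \<open>lpp\<close>.\<close>

definition shift_weights :: "(nat \<times> nat \<Rightarrow> real) \<Rightarrow> nat \<times> nat \<Rightarrow> real" where
  "shift_weights x = (\<lambda>(i, j). if i = 0 \<or> j = 0 then 0 else x (i - 1, j - 1))"

lemma lpp_shift_boundary: "lpp (shift_weights x) i 0 = 0" "lpp (shift_weights x) 0 j = 0"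
  by (simp_all add: lpp_row lpp_col shift_weights_def)

lemma lpp_shift_Suc: "lpp (shift_weights x) (Suc i) (Suc j) =
    x (i, j) + max (lpp (shift_weights x) i (Suc j)) (lpp (shift_weights x) (Suc i) j)"
  by (simp add: shift_weights_def)

lemma lpp_shift_nonneg:
  assumes "\<And>a. x a \<ge> 0"
  shows "lpp (shift_weights x) i j \<ge> 0"
proof -
  have "lpp (\<lambda>_. 0) i j = 0"
    by (induction "\<lambda>_::nat \<times> nat. 0::real" i j rule: lpp.induct) auto
  moreover have "lpp (\<lambda>_. 0) i j \<le> lpp (shift_weights x) i j"
    by (rule lpp_mono) (auto simp: shift_weights_def assms)
  ultimately show ?thesis by simp
qed

text \<open>The induction removes the last site, as the recursion does. The start of the path is
  left free; a one-site path is then covered by nonnegativity of the last-passage times.\<close>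

lemma path_weight_le_lpp:
  assumes x: "\<And>a. x a \<ge> 0" and "\<pi> \<noteq> []" "successively lattice_step \<pi>"
  shows "(\<Sum>z\<leftarrow>\<pi>. x z) \<le> lpp (shift_weights x) (Suc (fst (last \<pi>))) (Suc (snd (last \<pi>)))"
  using assms(2,3)
proof (induction \<pi> rule: rev_induct)
  case (snoc a \<pi>)
  obtain i j where a: "a = (i, j)" by force
  show ?case
  proof (cases "\<pi> = []")
    case True
    then show ?thesis
      using lpp_shift_nonneg[of x, OF x, of i "Suc j"]
      unfolding a by (auto simp: lpp_shift_Suc True simp del: lpp.simps)
  next
    case False
    then have IH: "(\<Sum>z\<leftarrow>\<pi>. x z) \<le> lpp (shift_weights x) (Suc (fst (last \<pi>))) (Suc (snd (last \<pi>)))"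
      and st: "lattice_step (last \<pi>) a"
      using snoc by (auto simp: successively_append_iff)
    then have "(\<Sum>z\<leftarrow>\<pi>. x z) \<le> max (lpp (shift_weights x) i (Suc j)) (lpp (shift_weights x) (Suc i) j)"
      unfolding lattice_step_def a by auto
    then show ?thesis unfolding a by (simp add: lpp_shift_Suc del: lpp.simps)
  qed
qed simp

text \<open>An optimal path is traced backwards: from each site it goes to the predecessor that
  attains the maximum in the recursion.\<close>

lemma lpp_le_path_weight:
  "\<exists>\<pi>\<in>lattice_paths (0, 0) (i, j). lpp (shift_weights x) (Suc i) (Suc j) \<le> (\<Sum>z\<leftarrow>\<pi>. x z)"
  if x: "\<And>a. x a \<ge> 0"
proof (induction "i + j" arbitrary: i j rule: less_induct)
  case less
  let ?S = "lpp (shift_weights x)"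
  have ext: "\<exists>\<pi>\<in>lattice_paths (0, 0) (i, j). ?S (Suc i) (Suc j) \<le> (\<Sum>z\<leftarrow>\<pi>. x z)"
    if "\<pi> \<in> lattice_paths (0, 0) b" "lattice_step b (i, j)"
      "max (?S i (Suc j)) (?S (Suc i) j) \<le> (\<Sum>z\<leftarrow>\<pi>. x z)" for \<pi> b
    using that by (intro bexI[of _ "\<pi> @ [(i, j)]"])
      (auto simp: lattice_paths_def successively_append_iff lpp_shift_Suc simp del: lpp.simps)
  show ?case
  proof (cases "i = 0 \<and> j = 0")
    case True
    then show ?thesis
      by (intro bexI[of _ "[(0, 0)]"])
        (auto simp: lattice_paths_def lpp_shift_Suc lpp_shift_boundary simp del: lpp.simps)
  next
    case False
    show ?thesis
    proof (cases "j = 0 \<or> (i \<noteq> 0 \<and> ?S i (Suc j) \<ge> ?S (Suc i) j)")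
      case True
      with False obtain i' where i': "i = Suc i'" by (cases i) auto
      \<comment> \<open>On the bottom row the competing value is the zero boundary, so the step to
        the left is optimal there. In the left column the other branch steps down for the same
        reason.\<close>
      have "max (?S i (Suc j)) (?S (Suc i) j) = ?S i (Suc j)"
        using True i' lpp_shift_nonneg[of x, OF x, of i "Suc j"] by (auto simp: lpp_shift_boundary simp del: lpp.simps)
      moreover obtain \<pi> where "\<pi> \<in> lattice_paths (0, 0) (i', j)" "?S (Suc i') (Suc j) \<le> (\<Sum>z\<leftarrow>\<pi>. x z)"
        using less[of i' j] i' by auto
      ultimately show ?thesis
        using i' by (intro ext[of \<pi> "(i', j)"]) (auto simp: lattice_step_def simp del: lpp.simps)
    next
      case F: False
      then obtain j' where j': "j = Suc j'" by (cases j) auto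
      have "max (?S i (Suc j)) (?S (Suc i) j) = ?S (Suc i) j"
        using F lpp_shift_nonneg[of x, OF x, of "Suc i" j] by (auto simp: lpp_shift_boundary simp del: lpp.simps)
      moreover obtain \<pi> where "\<pi> \<in> lattice_paths (0, 0) (i, j')" "?S (Suc i) (Suc j') \<le> (\<Sum>z\<leftarrow>\<pi>. x z)"
        using less[of i j'] j' by auto
      ultimately show ?thesis
        using j' by (intro ext[of \<pi> "(i, j')"]) (auto simp: lattice_step_def simp del: lpp.simps)
    qed
  qed
qed

text \<open>The extra term is the weight of the endpoint: the recursion counts it, the sum over
  \<open>butlast\<close> does not.\<close>

lemma last_passage_eq_lpp:
  assumes x: "\<And>a. x a \<ge> 0"
  shows "last_passage x k l + x (k, l) = lpp (shift_weights x) (Suc k) (Suc l)"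
proof -
  let ?P = "lattice_paths (0, 0) (k, l)"
  have split: "(\<Sum>z\<leftarrow>butlast \<pi>. x z) + x (k, l) = (\<Sum>z\<leftarrow>\<pi>. x z)" if "\<pi> \<in> ?P" for \<pi>
  proof -
    have "\<pi> = butlast \<pi> @ [(k, l)]"
      using that append_butlast_last_id[of \<pi>] by (auto simp: lattice_paths_def)
    then have "(\<Sum>z\<leftarrow>\<pi>. x z) = (\<Sum>z\<leftarrow>butlast \<pi> @ [(k, l)]. x z)" by simp
    then show ?thesis by simp
  qed
  have fin: "finite ((\<lambda>\<pi>. \<Sum>z\<leftarrow>butlast \<pi>. x z) ` ?P)" and ne: "(\<lambda>\<pi>. \<Sum>z\<leftarrow>butlast \<pi>. x z) ` ?P \<noteq> {}"
    using finite_lattice_paths lattice_paths_nonempty by auto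
  show ?thesis
  proof (rule antisym)
    have "(\<Sum>z\<leftarrow>butlast \<pi>. x z) \<le> lpp (shift_weights x) (Suc k) (Suc l) - x (k, l)" if "\<pi> \<in> ?P" for \<pi>
      using split[OF that] path_weight_le_lpp[of x \<pi>] that x by (auto simp: lattice_paths_def simp del: lpp.simps)
    then have "last_passage x k l \<le> lpp (shift_weights x) (Suc k) (Suc l) - x (k, l)"
      unfolding last_passage_def using fin ne by (intro Max.boundedI) (auto simp del: lpp.simps)
    then show "last_passage x k l + x (k, l) \<le> lpp (shift_weights x) (Suc k) (Suc l)"
      by simp
  next
    obtain \<pi> where \<pi>: "\<pi> \<in> ?P" "lpp (shift_weights x) (Suc k) (Suc l) \<le> (\<Sum>z\<leftarrow>\<pi>. x z)"
      using lpp_le_path_weight[of x k l] x by blast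
    have "(\<Sum>z\<leftarrow>butlast \<pi>. x z) \<le> last_passage x k l"
      unfolding last_passage_def using fin \<pi>(1) by (intro Max_ge) auto
    then show "lpp (shift_weights x) (Suc k) (Suc l) \<le> last_passage x k l + x (k, l)"
      using \<pi>(2) split[OF \<pi>(1)] by simp
  qed
qed

lemma measurable_lpp:
  assumes "\<And>a. (\<lambda>x. w x a) \<in> borel_measurable N"
  shows "(\<lambda>x. lpp (w x) i j) \<in> borel_measurable N"
proof (induction i arbitrary: j)
  case 0
  show ?case unfolding lpp_col using assms by simp
next
  case (Suc i)
  note left [measurable] = Suc.IH
  note assms [measurable]
  show ?case
  proof (induction j)
    case 0
    show ?case unfolding lpp_row using assms by simp
  next
    case (Suc j)
    note Suc.IH [measurable]
    show ?case by simp
  qed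
qed

lemma measurable_last_passage:
  assumes "\<And>a. (\<lambda>x. w x a) \<in> borel_measurable N"
  shows "(\<lambda>x. last_passage (w x) k l) \<in> borel_measurable N"
proof -
  have 1: "(\<lambda>x. \<Sum>z\<leftarrow>zs. w x z) \<in> borel_measurable N" for zs
    using assms by (induction zs) auto
  show ?thesis
    unfolding last_passage_def by (intro borel_measurable_Max finite_lattice_paths 1)
qed

section \<open>The Burke property\<close>

abbreviation expm :: "real \<Rightarrow> real measure" where
  "expm l \<equiv> density lborel (exponential_density l)"

text \<open>The map \<open>(I, J, w)\<close> to
  \<open>(w + max 0 (I - J), w + max 0 (J - I), min I J)\<close> is an involution, and on each of
  the regions \<open>I \<ge> J\<close> and \<open>I < J\<close> it is a translation of one variable
  combined with a permutation of the variables. Hence it preserves Lebesgue measure.\<close>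

lemma burke_lebesgue:
  fixes h :: "real \<Rightarrow> real \<Rightarrow> real \<Rightarrow> ennreal"
  assumes h: "(\<lambda>(a, b, c). h a b c) \<in> borel_measurable (borel \<Otimes>\<^sub>M borel \<Otimes>\<^sub>M borel)"
  shows "(\<integral>\<^sup>+w. \<integral>\<^sup>+J. \<integral>\<^sup>+I. h (w + max 0 (I - J)) (w + max 0 (J - I)) (min I J) \<partial>lborel \<partial>lborel \<partial>lborel)
    = (\<integral>\<^sup>+w. \<integral>\<^sup>+J. \<integral>\<^sup>+I. h I J w \<partial>lborel \<partial>lborel \<partial>lborel)" (is "?L = ?R")
proof -
  have m [measurable (raw)]: "(\<lambda>x. h (a x) (b x) (c x)) \<in> borel_measurable M"
    if "a \<in> borel_measurable M" "b \<in> borel_measurable M" "c \<in> borel_measurable M" for a b c and M :: "'m measure"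
    using measurable_compose[OF measurable_Pair[OF that(1) measurable_Pair[OF that(2,3)]] h] by simp
  define A where "A = (\<integral>\<^sup>+w. \<integral>\<^sup>+J. \<integral>\<^sup>+I. (if I \<ge> J then h I J w else 0) \<partial>lborel \<partial>lborel \<partial>lborel)"
  define B where "B = (\<integral>\<^sup>+w. \<integral>\<^sup>+J. \<integral>\<^sup>+I. (if I < J then h I J w else 0) \<partial>lborel \<partial>lborel \<partial>lborel)"
  have swap: "(\<integral>\<^sup>+x. \<integral>\<^sup>+y. g x y \<partial>lborel \<partial>lborel) = (\<integral>\<^sup>+y. \<integral>\<^sup>+x. g x y \<partial>lborel \<partial>lborel)"
    if "case_prod g \<in> borel_measurable (borel \<Otimes>\<^sub>M borel)" for g :: "real \<Rightarrow> real \<Rightarrow> ennreal"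
    using lborel_pair.Fubini'[of g] that by simp
  have R: "?R = A + B"
    unfolding A_def B_def
    by (simp flip: nn_integral_add add: if_distrib cong: if_cong)
  have L: "?L = (\<integral>\<^sup>+w. \<integral>\<^sup>+J. \<integral>\<^sup>+I. (if I \<ge> J then h (w + (I - J)) w J else 0) \<partial>lborel \<partial>lborel \<partial>lborel)
     + (\<integral>\<^sup>+w. \<integral>\<^sup>+J. \<integral>\<^sup>+I. (if I < J then h w (w + (J - I)) I else 0) \<partial>lborel \<partial>lborel \<partial>lborel)"
    (is "_ = ?L1 + ?L2")
    by (simp flip: nn_integral_add) (auto intro!: nn_integral_cong simp: max_def min_def)
  \<comment> \<open>With \<open>w\<close> and \<open>J\<close> fixed, translating \<open>I\<close>
    by \<open>w - J\<close> makes the first argument the integration variable; exchanging the names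
    of \<open>w\<close> and \<open>J\<close> then gives \<open>A\<close>. The second region is
    treated alike, with \<open>J\<close> translated.\<close>
  have "?L1 = (\<integral>\<^sup>+w. \<integral>\<^sup>+J. \<integral>\<^sup>+I. (if I \<ge> w then h I w J else 0) \<partial>lborel \<partial>lborel \<partial>lborel)"
  proof (rule nn_integral_cong, rule nn_integral_cong)
    fix w J :: real
    show "(\<integral>\<^sup>+I. (if I \<ge> J then h (w + (I - J)) w J else 0) \<partial>lborel)
      = (\<integral>\<^sup>+I. (if I \<ge> w then h I w J else 0) \<partial>lborel)"
      by (subst nn_integral_real_affine[where c = 1 and t = "w - J" and f = "\<lambda>I. if I \<ge> w then h I w J else 0"])
        (auto intro!: nn_integral_cong simp: algebra_simps)
  qed
  also have "\<dots> = A"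
    unfolding A_def by (subst swap) auto
  finally have L1: "?L1 = A" .
  have "?L2 = (\<integral>\<^sup>+w. \<integral>\<^sup>+I. \<integral>\<^sup>+J. (if I < J then h w (w + (J - I)) I else 0) \<partial>lborel \<partial>lborel \<partial>lborel)"
    by (rule nn_integral_cong) (subst swap, auto)
  also have "\<dots> = (\<integral>\<^sup>+w. \<integral>\<^sup>+I. \<integral>\<^sup>+J. (if w < J then h w J I else 0) \<partial>lborel \<partial>lborel \<partial>lborel)"
  proof (rule nn_integral_cong, rule nn_integral_cong)
    fix w I :: real
    show "(\<integral>\<^sup>+J. (if I < J then h w (w + (J - I)) I else 0) \<partial>lborel)
      = (\<integral>\<^sup>+J. (if w < J then h w J I else 0) \<partial>lborel)"
      by (subst nn_integral_real_affine[where c = 1 and t = "w - I" and f = "\<lambda>J. if w < J then h w J I else 0"])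
        (auto intro!: nn_integral_cong simp: algebra_simps)
  qed
  also have "\<dots> = (\<integral>\<^sup>+I. \<integral>\<^sup>+w. \<integral>\<^sup>+J. (if w < J then h w J I else 0) \<partial>lborel \<partial>lborel \<partial>lborel)"
    by (subst swap) auto
  also have "\<dots> = B"
    unfolding B_def by (rule nn_integral_cong) (subst swap, auto)
  finally have "?L2 = B" .
  with L L1 R show ?thesis by simp
qed

text \<open>Since \<open>min I J + max 0 (I - J) = I\<close>, the exponent
  \<open>p I + q J + (p + q) w\<close> is unchanged by the map; the third rate must be
  \<open>p + q\<close> for this balance. If an argument is negative, both sides vanish.\<close>

lemma exponential_density_burke:
  "exponential_density p (w + max 0 (I - J)) * exponential_density q (w + max 0 (J - I))
      * exponential_density (p + q) (min I J)
    = exponential_density p I * exponential_density q J * exponential_density (p + q) w"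
proof (cases "I \<ge> 0 \<and> J \<ge> 0 \<and> w \<ge> 0")
  case True
  then show ?thesis
    by (cases "I \<ge> J") (auto simp: exponential_density_def max_def min_def algebra_simps simp flip: exp_add)
next
  case False
  then show ?thesis
    by (cases "I \<ge> J") (auto simp: exponential_density_def max_def min_def)
qed

lemma burke_triple:
  fixes f :: "real \<Rightarrow> real \<Rightarrow> real \<Rightarrow> ennreal"
  assumes f: "(\<lambda>(a, b, c). f a b c) \<in> borel_measurable (borel \<Otimes>\<^sub>M borel \<Otimes>\<^sub>M borel)"
    and [arith]: "p > 0" "q > 0"
  shows "(\<integral>\<^sup>+w. \<integral>\<^sup>+J. \<integral>\<^sup>+I. f (w + max 0 (I - J)) (w + max 0 (J - I)) (min I J) \<partial>expm p \<partial>expm q \<partial>expm (p + q))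
    = (\<integral>\<^sup>+w. \<integral>\<^sup>+J. \<integral>\<^sup>+I. f I J w \<partial>expm p \<partial>expm q \<partial>expm (p + q))"
proof -
  have m [measurable (raw)]: "(\<lambda>x. f (a x) (b x) (c x)) \<in> borel_measurable M"
    if "a \<in> borel_measurable M" "b \<in> borel_measurable M" "c \<in> borel_measurable M" for a b c and M :: "'m measure"
    using measurable_compose[OF measurable_Pair[OF that(1) measurable_Pair[OF that(2,3)]] f] by simp
  define d where "d I J w = exponential_density p I * exponential_density q J * exponential_density (p + q) w" for I J w
  have dm [measurable]: "(\<lambda>x. d (a x) (b x) (c x)) \<in> borel_measurable M"
    if "a \<in> borel_measurable M" "b \<in> borel_measurable M" "c \<in> borel_measurable M" for a b c and M :: "'m measure"
    unfolding d_def using that by measurable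
  have e: "(\<integral>\<^sup>+w. \<integral>\<^sup>+J. \<integral>\<^sup>+I. g I J w \<partial>expm p \<partial>expm q \<partial>expm (p + q))
    = (\<integral>\<^sup>+w. \<integral>\<^sup>+J. \<integral>\<^sup>+I. ennreal (d I J w) * g I J w \<partial>lborel \<partial>lborel \<partial>lborel)"
    if g: "(\<lambda>(a, b, c). g a b c) \<in> borel_measurable (borel \<Otimes>\<^sub>M borel \<Otimes>\<^sub>M borel)"
    for g :: "real \<Rightarrow> real \<Rightarrow> real \<Rightarrow> ennreal"
  proof -
    have m [measurable (raw)]: "(\<lambda>x. g (a x) (b x) (c x)) \<in> borel_measurable M"
      if "a \<in> borel_measurable M" "b \<in> borel_measurable M" "c \<in> borel_measurable M" for a b c and M :: "'m measure"
      using measurable_compose[OF measurable_Pair[OF that(1) measurable_Pair[OF that(2,3)]] g] by simp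
    show ?thesis
      by (simp add: nn_integral_density flip: nn_integral_cmult)
        (intro nn_integral_cong, simp add: d_def ennreal_mult' exponential_density_nonneg mult_ac)
  qed
  have "(\<integral>\<^sup>+w. \<integral>\<^sup>+J. \<integral>\<^sup>+I. f (w + max 0 (I - J)) (w + max 0 (J - I)) (min I J) \<partial>expm p \<partial>expm q \<partial>expm (p + q))
    = (\<integral>\<^sup>+w. \<integral>\<^sup>+J. \<integral>\<^sup>+I. ennreal (d (w + max 0 (I - J)) (w + max 0 (J - I)) (min I J))
        * f (w + max 0 (I - J)) (w + max 0 (J - I)) (min I J) \<partial>lborel \<partial>lborel \<partial>lborel)"
    by (subst e) (simp_all add: d_def exponential_density_burke)
  also have "\<dots> = (\<integral>\<^sup>+w. \<integral>\<^sup>+J. \<integral>\<^sup>+I. ennreal (d I J w) * f I J w \<partial>lborel \<partial>lborel \<partial>lborel)"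
    by (rule burke_lebesgue[of "\<lambda>I J w. ennreal (d I J w) * f I J w"]) simp
  also have "\<dots> = (\<integral>\<^sup>+w. \<integral>\<^sup>+J. \<integral>\<^sup>+I. f I J w \<partial>expm p \<partial>expm q \<partial>expm (p + q))"
    by (subst e) simp_all
  finally show ?thesis .
qed

(* A corner flip; storing the minimum at s makes it preserve the law of the whole family. *)
definition flip :: "'i \<Rightarrow> 'i \<Rightarrow> 'i \<Rightarrow> ('i \<Rightarrow> real) \<Rightarrow> 'i \<Rightarrow> real" where
  "flip p q s y =
     y(p := y s + max 0 (y p - y q), q := y s + max 0 (y q - y p), s := min (y p) (y q))"

lemma measurable_flip:
  assumes "p \<in> A" "q \<in> A" "s \<in> A"
  shows "flip p q s \<in> Pi\<^sub>M A (\<lambda>_. borel) \<rightarrow>\<^sub>M Pi\<^sub>M A (\<lambda>_. borel)"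
proof (rule measurable_PiM_single')
  fix i assume "i \<in> A"
  then have [measurable]: "(\<lambda>y::'a \<Rightarrow> real. y i) \<in> borel_measurable (Pi\<^sub>M A (\<lambda>_. borel))"
    "(\<lambda>y::'a \<Rightarrow> real. y p) \<in> borel_measurable (Pi\<^sub>M A (\<lambda>_. borel))"
    "(\<lambda>y::'a \<Rightarrow> real. y q) \<in> borel_measurable (Pi\<^sub>M A (\<lambda>_. borel))"
    "(\<lambda>y::'a \<Rightarrow> real. y s) \<in> borel_measurable (Pi\<^sub>M A (\<lambda>_. borel))"
    using assms by (auto intro!: measurable_component_singleton)
  show "(\<lambda>y. flip p q s y i) \<in> borel_measurable (Pi\<^sub>M A (\<lambda>_. borel))"
    unfolding flip_def by (cases "i = s"; cases "i = q"; cases "i = p") simp_all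
next
  show "flip p q s \<in> space (Pi\<^sub>M A (\<lambda>_. borel)) \<rightarrow> (\<Pi>\<^sub>E i\<in>A. space borel)"
    using assms by (auto simp: space_PiM flip_def PiE_def extensional_def)
qed

text \<open>Only three coordinates move. Integrating over them first, with all others fixed, leaves
  exactly the situation of \<open>burke_triple\<close>.\<close>

lemma distr_flip:
  assumes A: "finite A" "p \<in> A" "q \<in> A" "s \<in> A" and ne: "p \<noteq> q" "p \<noteq> s" "q \<noteq> s"
    and \<rho>: "\<And>a. \<rho> a > 0" and \<rho>s: "\<rho> s = \<rho> p + \<rho> q"
  shows "distr (Pi\<^sub>M A (\<lambda>a. expm (\<rho> a))) (Pi\<^sub>M A (\<lambda>_. borel)) (flip p q s) = Pi\<^sub>M A (\<lambda>a. expm (\<rho> a))"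
proof -
  let ?P = "\<lambda>A. Pi\<^sub>M A (\<lambda>a. expm (\<rho> a))"
  interpret product_sigma_finite "\<lambda>a. expm (\<rho> a)"
    unfolding product_sigma_finite_def
    using \<rho> prob_space_exponential_density prob_space_imp_sigma_finite by blast
  have sets_P: "sets (?P A) = sets (Pi\<^sub>M A (\<lambda>_. borel))" for A
    by (intro sets_PiM_cong) auto
  have meas_P: "(?P A \<rightarrow>\<^sub>M L) = (Pi\<^sub>M A (\<lambda>_. borel) \<rightarrow>\<^sub>M L)" for A and L :: "'l measure"
    by (intro measurable_cong_sets sets_P refl)
  define A' where "A' = A - {p, q, s}"
  have A': "A = insert p (insert q (insert s A'))" "finite A'" "p \<notin> insert q (insert s A')"
    "q \<notin> insert s A'" "s \<notin> A'"
    using A ne by (auto simp: A'_def)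
  have flip[measurable]: "flip p q s \<in> ?P A \<rightarrow>\<^sub>M Pi\<^sub>M A (\<lambda>_. borel)"
    unfolding meas_P by (rule measurable_flip) (use A in auto)
  \<comment> \<open>Tonelli with the moving coordinates innermost, in the order of
    \<open>burke_triple\<close>; the outer variable keeps the coordinates in
    \<open>A'\<close>.\<close>
  have decomp: "integral\<^sup>N (?P A) f =
      (\<integral>\<^sup>+x. \<integral>\<^sup>+w. \<integral>\<^sup>+J. \<integral>\<^sup>+I. f (x(s := w, q := J, p := I))
         \<partial>expm (\<rho> p) \<partial>expm (\<rho> q) \<partial>expm (\<rho> s) \<partial>?P A')"
    if f: "f \<in> borel_measurable (Pi\<^sub>M A (\<lambda>_. borel))" for f
  proof -
    have 1: "f \<in> borel_measurable (?P (insert p (insert q (insert s A'))))"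
      using f by (simp add: meas_P A'(1))
    have upd: "(\<lambda>(x, y). f (x(p := y))) \<in>
        borel_measurable (?P (insert q (insert s A')) \<Otimes>\<^sub>M expm (\<rho> p))"
      using 1 by measurable
    have 2: "(\<lambda>x. \<integral>\<^sup>+I. f (x(p := I)) \<partial>expm (\<rho> p)) \<in> borel_measurable (?P (insert q (insert s A')))"
      by (rule sigma_finite_measure.borel_measurable_nn_integral[OF sigma_finite_measures upd])
    have upd: "(\<lambda>(x, y). \<integral>\<^sup>+I. f (x(q := y, p := I)) \<partial>expm (\<rho> p)) \<in>
        borel_measurable (?P (insert s A') \<Otimes>\<^sub>M expm (\<rho> q))"
      using 2 by measurable
    have 3: "(\<lambda>x. \<integral>\<^sup>+J. \<integral>\<^sup>+I. f (x(q := J, p := I)) \<partial>expm (\<rho> p) \<partial>expm (\<rho> q))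
        \<in> borel_measurable (?P (insert s A'))"
      by (rule sigma_finite_measure.borel_measurable_nn_integral[OF sigma_finite_measures upd])
    show ?thesis
      unfolding A'(1)
      using A'(2-) product_nn_integral_insert[OF _ A'(3) 1] product_nn_integral_insert[OF _ A'(4) 2]
        product_nn_integral_insert[OF _ A'(5) 3]
      by simp
  qed
  show ?thesis
  proof (rule measure_eqI)
    show "sets (distr (?P A) (Pi\<^sub>M A (\<lambda>_. borel)) (flip p q s)) = sets (?P A)"
      by (simp add: sets_P)
  next
    fix B assume "B \<in> sets (distr (?P A) (Pi\<^sub>M A (\<lambda>_. borel)) (flip p q s))"
    then have B: "B \<in> sets (Pi\<^sub>M A (\<lambda>_. borel))" by simp
    then have B': "B \<in> sets (?P A)" by (simp add: sets_P)
    let ?f = "indicator B :: _ \<Rightarrow> ennreal"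
    have f: "?f \<in> borel_measurable (Pi\<^sub>M A (\<lambda>_. borel))"
      using B by simp
    have "emeasure (distr (?P A) (Pi\<^sub>M A (\<lambda>_. borel)) (flip p q s)) B
        = integral\<^sup>N (distr (?P A) (Pi\<^sub>M A (\<lambda>_. borel)) (flip p q s)) ?f"
      using B by simp
    also have "\<dots> = (\<integral>\<^sup>+y. ?f (flip p q s y) \<partial>?P A)"
      by (rule nn_integral_distr[OF flip]) (use f in simp)
    also have "\<dots> = (\<integral>\<^sup>+x. \<integral>\<^sup>+w. \<integral>\<^sup>+J. \<integral>\<^sup>+I. ?f (flip p q s (x(s := w, q := J, p := I)))
         \<partial>expm (\<rho> p) \<partial>expm (\<rho> q) \<partial>expm (\<rho> s) \<partial>?P A')"
      by (rule decomp) (rule measurable_compose[OF measurable_flip f], use A in auto)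
    also have "\<dots> = (\<integral>\<^sup>+x. \<integral>\<^sup>+w. \<integral>\<^sup>+J. \<integral>\<^sup>+I. ?f (x(s := w, q := J, p := I))
         \<partial>expm (\<rho> p) \<partial>expm (\<rho> q) \<partial>expm (\<rho> s) \<partial>?P A')"
    proof (rule nn_integral_cong)
      fix x assume "x \<in> space (?P A')"
      then have x: "x \<in> (\<Pi>\<^sub>E i\<in>A'. UNIV)" by (simp add: space_PiM)
      have m: "(\<lambda>(a, b, c). ?f (x(s := c, q := b, p := a))) \<in> borel_measurable (borel \<Otimes>\<^sub>M borel \<Otimes>\<^sub>M borel)"
      proof -
        have "(\<lambda>(a, b, c). x(s := c, q := b, p := a)) \<in> borel \<Otimes>\<^sub>M borel \<Otimes>\<^sub>M borel \<rightarrow>\<^sub>M Pi\<^sub>M A (\<lambda>_. borel)"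
        proof (rule measurable_PiM_single')
          fix i assume "i \<in> A"
          show "(\<lambda>y. (case y of (a, b, c) \<Rightarrow> x(s := c, q := b, p := a)) i)
              \<in> borel_measurable (borel \<Otimes>\<^sub>M borel \<Otimes>\<^sub>M borel)"
            by (cases "i = s"; cases "i = q"; cases "i = p") (simp_all add: case_prod_beta')
        next
          show "(\<lambda>(a, b, c). x(s := c, q := b, p := a))
              \<in> space (borel \<Otimes>\<^sub>M borel \<Otimes>\<^sub>M borel) \<rightarrow> (\<Pi>\<^sub>E i\<in>A. space borel)"
            using x A'(1) by (auto simp: PiE_def extensional_def)
        qed
        from measurable_compose[OF this f] show ?thesis by (simp add: case_prod_beta')
      qed
      have "flip p q s (x(s := w, q := J, p := I)) =
          x(s := min I J, q := w + max 0 (J - I), p := w + max 0 (I - J))" for w J I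
        using ne by (auto simp: flip_def fun_eq_iff)
      then show "(\<integral>\<^sup>+w. \<integral>\<^sup>+J. \<integral>\<^sup>+I. ?f (flip p q s (x(s := w, q := J, p := I)))
           \<partial>expm (\<rho> p) \<partial>expm (\<rho> q) \<partial>expm (\<rho> s))
        = (\<integral>\<^sup>+w. \<integral>\<^sup>+J. \<integral>\<^sup>+I. ?f (x(s := w, q := J, p := I))
           \<partial>expm (\<rho> p) \<partial>expm (\<rho> q) \<partial>expm (\<rho> s))"
        using burke_triple[OF m \<rho>[of p] \<rho>[of q]] by (simp add: \<rho>s)
    qed
    also have "\<dots> = integral\<^sup>N (?P A) ?f"
      by (rule decomp[symmetric, OF f])
    also have "\<dots> = emeasure (?P A) B"
      using B' by simp
    finally show "emeasure (distr (?P A) (Pi\<^sub>M A (\<lambda>_. borel)) (flip p q s)) B = emeasure (?P A) B" .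
  qed
qed

(* Coordinate (i, 0) holds the current horizontal increment of column i, and (0, j) the current
   vertical increment of row j. *)
primrec flip_col :: "nat \<Rightarrow> nat \<Rightarrow> (nat \<times> nat \<Rightarrow> real) \<Rightarrow> nat \<times> nat \<Rightarrow> real" where
  "flip_col i 0 y = y"
| "flip_col i (Suc j) y = flip (i, 0) (0, Suc j) (i, Suc j) (flip_col i j y)"

primrec flip_grid :: "nat \<Rightarrow> nat \<Rightarrow> (nat \<times> nat \<Rightarrow> real) \<Rightarrow> nat \<times> nat \<Rightarrow> real" where
  "flip_grid 0 l y = y"
| "flip_grid (Suc i) l y = flip_col (Suc i) l (flip_grid i l y)"

text \<open>The invariant of a sweep up one column after \<open>m\<close> flips: the rows below
  \<open>m\<close> already hold the vertical increments of column \<open>Suc i\<close>, the other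
  rows still those of column \<open>i\<close>, and the weights yet to be read are untouched.\<close>

lemma flip_col_eq:
  assumes v: "\<And>j. j < l \<Longrightarrow> y (0, Suc j) = vinc w i j"
    and w: "\<And>i' j. i' > i \<Longrightarrow> y (i', j) = w (i', j)"
    and "m \<le> l"
  shows "flip_col (Suc i) m y (Suc i, 0) = hinc w i m
    \<and> (\<forall>j<m. flip_col (Suc i) m y (0, Suc j) = vinc w (Suc i) j)
    \<and> (\<forall>j\<ge>m. j < l \<longrightarrow> flip_col (Suc i) m y (0, Suc j) = vinc w i j)
    \<and> (\<forall>j\<ge>m. flip_col (Suc i) m y (Suc i, Suc j) = w (Suc i, Suc j))
    \<and> (\<forall>i'>Suc i. \<forall>j. flip_col (Suc i) m y (i', j) = w (i', j))"
  using \<open>m \<le> l\<close>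
proof (induction m)
  case 0
  then show ?case using v w by (auto simp: hinc_0)
next
  case (Suc m)
  then show ?case
    by (auto simp: flip_def hinc_Suc vinc_Suc less_Suc_eq)
qed

lemma flip_grid_eq:
  "(\<forall>j<l. flip_grid i l w (0, Suc j) = vinc w i j) \<and> (\<forall>i'>i. \<forall>j. flip_grid i l w (i', j) = w (i', j))"
proof (induction i)
  case 0
  then show ?case by (simp add: vinc_0)
next
  case (Suc i)
  then show ?case
    using flip_col_eq[of l "flip_grid i l w" w i l] by simp
qed

text \<open>A flip puts back at each index a variable of the rate belonging to that index, the
  minimum at \<open>s\<close> having rate \<open>\<rho> p + \<rho> q\<close>. So one product law is
  invariant under every flip of the sweep, and invariance passes to compositions.\<close>

lemma flip_grid_measure:
  fixes k l :: nat
  defines "A \<equiv> {..k} \<times> {..l}"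
  assumes \<rho>: "\<And>a. \<rho> a > 0" and sum: "\<And>i j. \<rho> (Suc i, Suc j) = \<rho> (Suc i, 0) + \<rho> (0, Suc j)"
    and i: "i \<le> k"
  shows "flip_grid i l \<in> Pi\<^sub>M A (\<lambda>_. borel) \<rightarrow>\<^sub>M Pi\<^sub>M A (\<lambda>_. borel) \<and>
    distr (Pi\<^sub>M A (\<lambda>a. expm (\<rho> a))) (Pi\<^sub>M A (\<lambda>_. borel)) (flip_grid i l) = Pi\<^sub>M A (\<lambda>a. expm (\<rho> a))"
proof -
  let ?P = "Pi\<^sub>M A (\<lambda>a. expm (\<rho> a))" and ?B = "Pi\<^sub>M A (\<lambda>_. borel) :: (nat \<times> nat \<Rightarrow> real) measure"
  have sets_P: "sets ?P = sets ?B"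
    by (intro sets_PiM_cong) auto
  have meas_P: "(?P \<rightarrow>\<^sub>M L) = (?B \<rightarrow>\<^sub>M L)" for L :: "'l measure"
    by (intro measurable_cong_sets sets_P refl)
  have comp: "(\<lambda>y. F (H y)) \<in> ?B \<rightarrow>\<^sub>M ?B \<and> distr ?P ?B (\<lambda>y. F (H y)) = ?P"
    if F: "F \<in> ?B \<rightarrow>\<^sub>M ?B \<and> distr ?P ?B F = ?P" and H: "H \<in> ?B \<rightarrow>\<^sub>M ?B \<and> distr ?P ?B H = ?P" for F H
  proof
    show "(\<lambda>y. F (H y)) \<in> ?B \<rightarrow>\<^sub>M ?B"
      using measurable_compose[of H ?B ?B F ?B] F H by auto
    show "distr ?P ?B (\<lambda>y. F (H y)) = ?P"
      using distr_distr[of F ?B ?B H ?P] F H by (simp add: meas_P comp_def)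
  qed
  have col: "flip_col (Suc i) m \<in> ?B \<rightarrow>\<^sub>M ?B \<and> distr ?P ?B (flip_col (Suc i) m) = ?P"
    if "Suc i \<le> k" "m \<le> l" for i m
    using that(2)
  proof (induction m)
    case 0
    have "distr ?P ?B (\<lambda>y. y) = ?P"
      by (rule distr_id2) (rule sets_P[symmetric])
    then show ?case by simp
  next
    case (Suc m)
    have "flip (Suc i, 0) (0, Suc m) (Suc i, Suc m) \<in> ?B \<rightarrow>\<^sub>M ?B \<and>
        distr ?P ?B (flip (Suc i, 0) (0, Suc m) (Suc i, Suc m)) = ?P"
      using that(1) Suc.prems
      by (intro conjI measurable_flip distr_flip \<rho> sum) (auto simp: A_def)
    from comp[OF this Suc.IH] Suc.prems show ?case by simp
  qed
  show ?thesis
    using i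
  proof (induction i)
    case 0
    have "distr ?P ?B (\<lambda>y. y) = ?P"
      by (rule distr_id2) (rule sets_P[symmetric])
    then show ?case by simp
  next
    case (Suc i)
    from comp[OF col[OF Suc.prems, of l] Suc.IH] Suc.prems show ?case by simp
  qed
qed

text \<open>After \<open>k\<close> columns the coordinates \<open>(0, Suc j)\<close> hold the
  vertical increments at column \<open>k\<close>, and the law of the family is still the initial
  one, under which these coordinates are the weights of the left axis.\<close>

lemma burke_column:
  fixes k l :: nat
  defines "A \<equiv> {..k} \<times> {..l}"
  assumes \<rho>: "\<And>a. \<rho> a > 0" and sum: "\<And>i j. \<rho> (Suc i, Suc j) = \<rho> (Suc i, 0) + \<rho> (0, Suc j)"
  shows "distr (Pi\<^sub>M A (\<lambda>a. expm (\<rho> a))) borel (\<lambda>y. lpp y k l - lpp y k 0)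
    = distr (Pi\<^sub>M A (\<lambda>a. expm (\<rho> a))) borel (\<lambda>y. \<Sum>j<l. y (0, Suc j))"
proof -
  let ?P = "Pi\<^sub>M A (\<lambda>a. expm (\<rho> a))" and ?B = "Pi\<^sub>M A (\<lambda>_. borel) :: (nat \<times> nat \<Rightarrow> real) measure"
  have sets_P: "sets ?P = sets ?B"
    by (intro sets_PiM_cong) auto
  have meas_P: "(?P \<rightarrow>\<^sub>M L) = (?B \<rightarrow>\<^sub>M L)" for L :: "'l measure"
    by (intro measurable_cong_sets sets_P refl)
  have m: "(\<lambda>y. \<Sum>j<l. y (0, Suc j)) \<in> borel_measurable ?B"
    by (intro borel_measurable_sum measurable_component_singleton) (auto simp: A_def)
  have F: "flip_grid k l \<in> ?B \<rightarrow>\<^sub>M ?B \<and> distr ?P ?B (flip_grid k l) = ?P"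
    unfolding A_def by (rule flip_grid_measure[OF \<rho> sum order_refl])
  have "distr ?P borel (\<lambda>y. \<Sum>j<l. y (0, Suc j)) = distr (distr ?P ?B (flip_grid k l)) borel (\<lambda>y. \<Sum>j<l. y (0, Suc j))"
    using F by simp
  also have "\<dots> = distr ?P borel (\<lambda>y. \<Sum>j<l. flip_grid k l y (0, Suc j))"
    using F m by (subst distr_distr) (auto simp: meas_P comp_def)
  also have "(\<lambda>y. \<Sum>j<l. flip_grid k l y (0, Suc j)) = (\<lambda>y. lpp y k l - lpp y k 0)"
    using flip_grid_eq[of l k] by (simp add: lpp_eq_sum_vinc)
  finally show ?thesis by simp
qed

section \<open>Convergence in probability\<close>

text \<open>Convergence in probability to a constant. It involves each \<open>Y n\<close> only
  through its law, which allows a change of probability space; measurability is bundled because the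
  library measure of a nonmeasurable set would say nothing.\<close>

definition plim :: "'a measure \<Rightarrow> (nat \<Rightarrow> 'a \<Rightarrow> real) \<Rightarrow> real \<Rightarrow> bool" where
  "plim N Y a \<longleftrightarrow> (\<forall>n. Y n \<in> borel_measurable N) \<and>
     (\<forall>\<epsilon>>0. (\<lambda>n. measure N {x\<in>space N. \<epsilon> \<le> \<bar>Y n x - a\<bar>}) \<longlonglongrightarrow> 0)"

lemma plim_measurable: "plim N Y a \<Longrightarrow> Y n \<in> borel_measurable N"
  by (simp add: plim_def)

text \<open>A deviation of \<open>h\<close> by \<epsilon> forces one of the arguments to deviate by
  \<epsilon>/2. The Lipschitz condition is met by sum, difference and maximum alike.\<close>

lemma (in prob_space) plim_comp2:
  assumes Y: "plim M Y a" and Z: "plim M Z b"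
    and m: "\<And>n. (\<lambda>x. h (Y n x) (Z n x)) \<in> borel_measurable M"
    and h: "\<And>y z. \<bar>h y z - h a b\<bar> \<le> \<bar>y - a\<bar> + \<bar>z - b\<bar>"
  shows "plim M (\<lambda>n x. h (Y n x) (Z n x)) (h a b)"
  unfolding plim_def
proof (intro conjI allI impI m)
  fix \<epsilon> :: real assume "\<epsilon> > 0"
  note [measurable] = plim_measurable[OF Y] plim_measurable[OF Z] m
  have "(\<lambda>n. measure M {x\<in>space M. \<epsilon> / 2 \<le> \<bar>Y n x - a\<bar>} + measure M {x\<in>space M. \<epsilon> / 2 \<le> \<bar>Z n x - b\<bar>})
      \<longlonglongrightarrow> 0"
    using Y[unfolded plim_def, THEN conjunct2, rule_format, of "\<epsilon> / 2"]
      Z[unfolded plim_def, THEN conjunct2, rule_format, of "\<epsilon> / 2"] \<open>\<epsilon> > 0\<close>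
    by (intro tendsto_add_zero) simp_all
  moreover have "norm (measure M {x\<in>space M. \<epsilon> \<le> \<bar>h (Y n x) (Z n x) - h a b\<bar>})
      \<le> measure M {x\<in>space M. \<epsilon> / 2 \<le> \<bar>Y n x - a\<bar>} + measure M {x\<in>space M. \<epsilon> / 2 \<le> \<bar>Z n x - b\<bar>}" for n
  proof -
    have "{x\<in>space M. \<epsilon> \<le> \<bar>h (Y n x) (Z n x) - h a b\<bar>}
        \<subseteq> {x\<in>space M. \<epsilon> / 2 \<le> \<bar>Y n x - a\<bar>} \<union> {x\<in>space M. \<epsilon> / 2 \<le> \<bar>Z n x - b\<bar>}"
    proof safe
      fix x assume "\<epsilon> \<le> \<bar>h (Y n x) (Z n x) - h a b\<bar>" "\<not> \<epsilon> / 2 \<le> \<bar>Z n x - b\<bar>"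
      then show "\<epsilon> / 2 \<le> \<bar>Y n x - a\<bar>" using h[of "Y n x" "Z n x"] by linarith
    qed
    then have "measure M {x\<in>space M. \<epsilon> \<le> \<bar>h (Y n x) (Z n x) - h a b\<bar>}
        \<le> measure M ({x\<in>space M. \<epsilon> / 2 \<le> \<bar>Y n x - a\<bar>} \<union> {x\<in>space M. \<epsilon> / 2 \<le> \<bar>Z n x - b\<bar>})"
      by (intro finite_measure_mono) simp_all
    also have "\<dots> \<le> measure M {x\<in>space M. \<epsilon> / 2 \<le> \<bar>Y n x - a\<bar>} + measure M {x\<in>space M. \<epsilon> / 2 \<le> \<bar>Z n x - b\<bar>}"
      by (intro measure_Un_le) simp_all
    finally show ?thesis by simp
  qed
  ultimately show "(\<lambda>n. measure M {x\<in>space M. \<epsilon> \<le> \<bar>h (Y n x) (Z n x) - h a b\<bar>}) \<longlonglongrightarrow> 0"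
    by (rule Lim_null_comparison[OF always_eventually[OF allI], rotated])
qed

lemma (in prob_space)
  assumes Y: "plim M Y a" and Z: "plim M Z b"
  shows plim_add: "plim M (\<lambda>n x. Y n x + Z n x) (a + b)"
    and plim_diff: "plim M (\<lambda>n x. Y n x - Z n x) (a - b)"
    and plim_max: "plim M (\<lambda>n x. max (Y n x) (Z n x)) (max a b)"
proof -
  note [measurable] = plim_measurable[OF Y] plim_measurable[OF Z]
  show "plim M (\<lambda>n x. Y n x + Z n x) (a + b)"
    by (rule plim_comp2[OF Y Z]) auto
  show "plim M (\<lambda>n x. Y n x - Z n x) (a - b)"
    by (rule plim_comp2[OF Y Z]) auto
  show "plim M (\<lambda>n x. max (Y n x) (Z n x)) (max a b)"
    by (rule plim_comp2[OF Y Z]) auto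
qed

text \<open>Laws are compared for each \<open>n\<close> separately: with a constant limit, the joint
  law of the sequence does not enter.\<close>

lemma plim_distr_cong:
  assumes Y: "plim N Y a" and Z: "\<And>n. Z n \<in> borel_measurable N'"
    and eq: "\<And>n. distr N' borel (Z n) = distr N borel (Y n)"
  shows "plim N' Z a"
  unfolding plim_def
proof (intro conjI allI impI Z)
  fix \<epsilon> :: real assume "\<epsilon> > 0"
  have *: "measure L {x\<in>space L. \<epsilon> \<le> \<bar>U x - a\<bar>} = measure (distr L borel U) {u. \<epsilon> \<le> \<bar>u - a\<bar>}"
    if "U \<in> borel_measurable L" for U and L :: "'l measure"
    by (subst measure_distr[OF that]) (auto intro!: arg_cong[where f = "measure L"])
  show "(\<lambda>n. measure N' {x\<in>space N'. \<epsilon> \<le> \<bar>Z n x - a\<bar>}) \<longlonglongrightarrow> 0"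
    using Y[unfolded plim_def, THEN conjunct2, rule_format, OF \<open>\<epsilon> > 0\<close>]
    by (simp only: *[OF Z] *[OF plim_measurable[OF Y]] eq)
qed

lemma (in prob_space) plim_le:
  assumes Y: "plim M Y a" and Z: "plim M Z b" and le: "\<And>n. AE x in M. Y n x \<le> Z n x"
  shows "a \<le> b"
proof (rule ccontr)
  assume "\<not> a \<le> b"
  \<comment> \<open>With a third of the gap, \<open>Y n\<close> within \<epsilon> of
    \<open>a\<close> and \<open>Z n\<close> within \<epsilon> of \<open>b\<close> would give
    \<open>Y n > Z n\<close>. So the two deviation events cover the space almost surely, although
    their probabilities tend to 0.\<close>
  define \<epsilon> where "\<epsilon> = (a - b) / 3"
  have "\<epsilon> > 0" using \<open>\<not> a \<le> b\<close> by (simp add: \<epsilon>_def)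
  note [measurable] = plim_measurable[OF Y] plim_measurable[OF Z]
  have "(\<lambda>n. measure M {x\<in>space M. \<epsilon> \<le> \<bar>Y n x - a\<bar>} + measure M {x\<in>space M. \<epsilon> \<le> \<bar>Z n x - b\<bar>})
      \<longlonglongrightarrow> 0 + 0"
    using Y Z \<open>\<epsilon> > 0\<close> unfolding plim_def by (intro tendsto_add) auto
  then have "eventually (\<lambda>n. measure M {x\<in>space M. \<epsilon> \<le> \<bar>Y n x - a\<bar>}
      + measure M {x\<in>space M. \<epsilon> \<le> \<bar>Z n x - b\<bar>} < 1) sequentially"
    by (rule order_tendstoD) simp
  then obtain n where n: "measure M {x\<in>space M. \<epsilon> \<le> \<bar>Y n x - a\<bar>}
      + measure M {x\<in>space M. \<epsilon> \<le> \<bar>Z n x - b\<bar>} < 1"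
    by (auto simp: eventually_sequentially)
  have "1 = measure M (space M)" by (simp add: prob_space)
  also have "\<dots> \<le> measure M ({x\<in>space M. \<epsilon> \<le> \<bar>Y n x - a\<bar>} \<union> {x\<in>space M. \<epsilon> \<le> \<bar>Z n x - b\<bar>})"
  proof (rule finite_measure_mono_AE)
    show "AE x in M. x \<in> space M \<longrightarrow> x \<in> {x\<in>space M. \<epsilon> \<le> \<bar>Y n x - a\<bar>} \<union> {x\<in>space M. \<epsilon> \<le> \<bar>Z n x - b\<bar>}"
      using le[of n] \<open>\<not> a \<le> b\<close> by eventually_elim (auto simp: \<epsilon>_def abs_if split: if_splits)
  qed simp
  also have "\<dots> \<le> measure M {x\<in>space M. \<epsilon> \<le> \<bar>Y n x - a\<bar>} + measure M {x\<in>space M. \<epsilon> \<le> \<bar>Z n x - b\<bar>}"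
    by (intro measure_Un_le) simp_all
  finally show False using n by simp
qed

lemma (in prob_space) plim_AE:
  assumes Y: "\<And>n. Y n \<in> borel_measurable M" and lim: "AE x in M. (\<lambda>n. Y n x) \<longlonglongrightarrow> a"
  shows "plim M Y a"
  unfolding plim_def
proof (intro conjI allI impI Y)
  fix \<epsilon> :: real assume "\<epsilon> > 0"
  note Y[measurable]
  have "(\<lambda>n. \<integral>x. indicator {x. \<epsilon> \<le> \<bar>x - a\<bar>} (Y n x) \<partial>M) \<longlonglongrightarrow> (\<integral>x. 0 \<partial>M :: real)"
  proof (rule integral_dominated_convergence[where w = "\<lambda>_. 1"])
    show "AE x in M. (\<lambda>n. indicator {x. \<epsilon> \<le> \<bar>x - a\<bar>} (Y n x)) \<longlonglongrightarrow> (0::real)"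
      using lim
    proof eventually_elim
      case (elim x)
      have "eventually (\<lambda>n. dist (Y n x) a < \<epsilon>) sequentially"
        using elim \<open>\<epsilon> > 0\<close> by (simp add: tendstoD)
      then have "eventually (\<lambda>n. indicator {x. \<epsilon> \<le> \<bar>x - a\<bar>} (Y n x) = (0::real)) sequentially"
        by eventually_elim (auto simp: dist_real_def indicator_def)
      then show ?case by (rule tendsto_eventually)
    qed
  qed (auto simp: indicator_def)
  moreover have "(\<integral>x. indicator {x. \<epsilon> \<le> \<bar>x - a\<bar>} (Y n x) \<partial>M) = measure M {x\<in>space M. \<epsilon> \<le> \<bar>Y n x - a\<bar>}" for n
  proof -
    have "(\<integral>x. indicator {x. \<epsilon> \<le> \<bar>x - a\<bar>} (Y n x) \<partial>M)
        = (\<integral>x. indicator {x\<in>space M. \<epsilon> \<le> \<bar>Y n x - a\<bar>} x \<partial>M :: real)"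
      by (intro Bochner_Integration.integral_cong) (auto simp: indicator_def)
    then show ?thesis by simp
  qed
  ultimately show "(\<lambda>n. measure M {x\<in>space M. \<epsilon> \<le> \<bar>Y n x - a\<bar>}) \<longlonglongrightarrow> 0" by simp
qed

lemma (in prob_space) uncorrelated_sum_deviation:
  fixes Y :: "nat \<Rightarrow> 'a \<Rightarrow> real"
  assumes Y [measurable]: "\<And>j. Y j \<in> borel_measurable M"
    and int: "\<And>i j. integrable M (\<lambda>x. Y i x * Y j x)"
    and mean: "\<And>j. integrable M (Y j)" "\<And>j. expectation (Y j) = \<gamma>"
    and cov: "\<And>i j. i \<noteq> j \<Longrightarrow> expectation (\<lambda>x. Y i x * Y j x) = \<gamma>\<^sup>2"
    and sq: "\<And>j. expectation (\<lambda>x. Y j x * Y j x) \<le> K" and "t > 0"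
  shows "measure M {x\<in>space M. t \<le> \<bar>(\<Sum>j<m. Y j x) - real m * \<gamma>\<bar>} \<le> real m * K / t\<^sup>2"
proof -
  let ?S = "\<lambda>x. \<Sum>j<m. Y j x"
  have sqr: "(?S x)\<^sup>2 = (\<Sum>i<m. \<Sum>j<m. Y i x * Y j x)" for x
    by (simp add: power2_eq_square sum_product)
  have intS: "integrable M (\<lambda>x. (?S x)\<^sup>2)"
    unfolding sqr using int by simp
  have ES: "expectation ?S = real m * \<gamma>"
    using mean by simp
  have "expectation (\<lambda>x. (?S x)\<^sup>2) = (\<Sum>i<m. \<Sum>j<m. expectation (\<lambda>x. Y i x * Y j x))"
    unfolding sqr using int by simp
  \<comment> \<open>\<open>K\<close> bounds the second moment, not the variance. Adding
    \<open>\<gamma>\<^sup>2\<close> on the diagonal as well loses nothing that matters and makes the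
    square of the mean split off exactly.\<close>
  also have "\<dots> \<le> (\<Sum>i<m. \<Sum>j<m. \<gamma>\<^sup>2 + (if i = j then K else 0))"
  proof (intro sum_mono)
    fix i j
    show "expectation (\<lambda>x. Y i x * Y j x) \<le> \<gamma>\<^sup>2 + (if i = j then K else 0)"
      using cov[of i j] sq[of i] by (cases "i = j") (auto intro: add_increasing)
  qed
  also have "\<dots> = (real m * \<gamma>)\<^sup>2 + real m * K"
    by (simp add: sum.distrib power2_eq_square algebra_simps)
  finally have "variance ?S \<le> real m * K"
    using intS mean by (subst variance_eq) (auto simp: ES)
  moreover have "measure M {x\<in>space M. t \<le> \<bar>?S x - expectation ?S\<bar>} \<le> variance ?S / t\<^sup>2"
    using intS \<open>t > 0\<close> by (intro Chebyshev_inequality) auto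
  ultimately show ?thesis
    unfolding ES by (meson divide_right_mono order_trans zero_le_power2)
qed

text \<open>The number of terms \<open>m n\<close> is only asymptotically \<open>\<theta> n\<close>.
  Half of \<epsilon> absorbs the error in the mean, the other half is left to Chebyshev, whose bound
  is of order \<open>1 / n\<close>.\<close>

lemma (in prob_space) plim_uncorrelated_mean:
  fixes Y :: "nat \<Rightarrow> 'a \<Rightarrow> real"
  assumes Y [measurable]: "\<And>j. Y j \<in> borel_measurable M"
    and int: "\<And>i j. integrable M (\<lambda>x. Y i x * Y j x)"
    and mean: "\<And>j. integrable M (Y j)" "\<And>j. expectation (Y j) = \<gamma>"
    and cov: "\<And>i j. i \<noteq> j \<Longrightarrow> expectation (\<lambda>x. Y i x * Y j x) = \<gamma>\<^sup>2"
    and sq: "\<And>j. expectation (\<lambda>x. Y j x * Y j x) \<le> K"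
    and m: "(\<lambda>n. real (m n) / real n) \<longlonglongrightarrow> \<theta>"
  shows "plim M (\<lambda>n x. (\<Sum>j<m n. Y j x) / real n) (\<theta> * \<gamma>)"
  unfolding plim_def
proof (intro conjI allI impI)
  fix \<epsilon> :: real assume "\<epsilon> > 0"
  have tri: "\<epsilon> / 2 \<le> \<bar>s - u\<bar>" if "\<epsilon> \<le> \<bar>s - v\<bar>" "\<bar>u - v\<bar> < \<epsilon> / 2" for s u v :: real
    using that by linarith
  let ?p = "\<lambda>n. measure M {x\<in>space M. \<epsilon> \<le> \<bar>(\<Sum>j<m n. Y j x) / real n - \<theta> * \<gamma>\<bar>}"
  have lim: "(\<lambda>n. (real (m n) / real n) * (K / (\<epsilon> / 2)\<^sup>2) * (1 / real n)) \<longlonglongrightarrow> \<theta> * (K / (\<epsilon> / 2)\<^sup>2) * 0"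
    by (intro tendsto_mult m tendsto_const lim_1_over_n)
  have "(\<lambda>n. real (m n) / real n * \<gamma>) \<longlonglongrightarrow> \<theta> * \<gamma>"
    by (intro tendsto_mult m tendsto_const)
  then have "eventually (\<lambda>n. dist (real (m n) / real n * \<gamma>) (\<theta> * \<gamma>) < \<epsilon> / 2) sequentially"
    using \<open>\<epsilon> > 0\<close> by (intro tendstoD) auto
  then have "eventually (\<lambda>n. ?p n \<le> (real (m n) / real n) * (K / (\<epsilon> / 2)\<^sup>2) * (1 / real n)) sequentially"
    using eventually_gt_at_top[of 0]
  proof eventually_elim
    case (elim n)
    have "{x\<in>space M. \<epsilon> \<le> \<bar>(\<Sum>j<m n. Y j x) / real n - \<theta> * \<gamma>\<bar>}
        \<subseteq> {x\<in>space M. real n * (\<epsilon> / 2) \<le> \<bar>(\<Sum>j<m n. Y j x) - real (m n) * \<gamma>\<bar>}"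
    proof safe
      fix x assume dev: "\<epsilon> \<le> \<bar>(\<Sum>j<m n. Y j x) / real n - \<theta> * \<gamma>\<bar>"
      have "\<epsilon> / 2 \<le> \<bar>(\<Sum>j<m n. Y j x) / real n - real (m n) / real n * \<gamma>\<bar>"
        by (rule tri[OF dev]) (use elim in \<open>simp add: dist_real_def\<close>)
      also have "\<dots> = \<bar>((\<Sum>j<m n. Y j x) - real (m n) * \<gamma>) / real n\<bar>"
        by (simp add: diff_divide_distrib)
      also have "\<dots> = \<bar>(\<Sum>j<m n. Y j x) - real (m n) * \<gamma>\<bar> / real n"
        by (simp add: abs_divide)
      finally show "real n * (\<epsilon> / 2) \<le> \<bar>(\<Sum>j<m n. Y j x) - real (m n) * \<gamma>\<bar>"
        using elim by (simp add: pos_le_divide_eq mult.commute)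
    qed
    then have "?p n \<le> measure M {x\<in>space M. real n * (\<epsilon> / 2) \<le> \<bar>(\<Sum>j<m n. Y j x) - real (m n) * \<gamma>\<bar>}"
      by (intro finite_measure_mono) simp_all
    also have "\<dots> \<le> real (m n) * K / (real n * (\<epsilon> / 2))\<^sup>2"
      using elim \<open>\<epsilon> > 0\<close> by (intro uncorrelated_sum_deviation int mean cov sq) auto
    also have "\<dots> = (real (m n) / real n) * (K / (\<epsilon> / 2)\<^sup>2) * (1 / real n)"
      by (simp add: power2_eq_square mult_ac)
    finally show ?case .
  qed
  then have "eventually (\<lambda>n. norm (?p n) \<le> (real (m n) / real n) * (K / (\<epsilon> / 2)\<^sup>2) * (1 / real n)) sequentially"
    by simp
  moreover have "(\<lambda>n. (real (m n) / real n) * (K / (\<epsilon> / 2)\<^sup>2) * (1 / real n)) \<longlonglongrightarrow> 0"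
    using lim by simp
  ultimately show "?p \<longlonglongrightarrow> 0"
    by (rule Lim_null_comparison)
qed simp

section \<open>Independent exponential variables\<close>

lemma prob_space_expm: "l > 0 \<Longrightarrow> prob_space (expm l)"
  by (rule prob_space_exponential_density)

lemma distributed_expm:
  "l > 0 \<Longrightarrow> distributed (expm l) lborel (\<lambda>x. x) (exponential_density l)"
  by (auto simp: distributed_def exponential_density_nonneg intro!: distr_id2)

lemma distr_expm_scale:
  assumes "l > 0"
  shows "distr (expm 1) borel (\<lambda>x. x / l) = expm l"
proof -
  interpret prob_space "expm 1" by (rule prob_space_expm) simp
  have "distributed (expm 1) lborel (\<lambda>x. x / l) (exponential_density l)"
  proof (subst exponential_distributed_iff[OF assms], intro conjI allI impI)
    fix a :: real assume "a \<ge> 0"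
    then have "prob {x \<in> space (expm 1). x \<le> a * l} = 1 - exp (- (a * l) * 1)"
      using exponential_distributedD_le[OF distributed_expm, of "a * l"] assms by simp
    then show "prob {x \<in> space (expm 1). x / l \<le> a} = 1 - exp (- a * l)"
      using assms by (simp add: pos_divide_le_eq)
  qed simp
  note distributed_distr_eq_density[OF this]
  moreover have "distr (expm 1) borel (\<lambda>x. x / l) = distr (expm 1) lborel (\<lambda>x. x / l)"
    by (rule distr_cong) auto
  ultimately show ?thesis by simp
qed

lemma expm_moments:
  shows expm_int: "integrable (expm 1) (\<lambda>x. x)" "integrable (expm 1) (\<lambda>x. x * x)"
    and expm_mean: "(\<integral>x. x \<partial>expm 1) = 1"
    and expm_square: "(\<integral>x. x * x \<partial>expm 1) = 2"
proof -
  interpret prob_space "expm 1" by (rule prob_space_expm) simp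
  have D: "distributed (expm 1) lborel (\<lambda>x. x) (erlang_density 0 1)"
    by (rule distributed_expm) simp
  have E2: "expectation (\<lambda>x. x ^ 2) = 2"
    using erlang_ith_moment[OF _ D, of 2] by simp
  \<comment> \<open>A function that is not integrable has integral 0 by convention, so a nonzero
    value proves integrability.\<close>
  then have I2: "integrable (expm 1) (\<lambda>x. x ^ 2)"
    by (metis not_integrable_integral_eq zero_neq_numeral)
  show "integrable (expm 1) (\<lambda>x. x * x)" "(\<integral>x. x * x \<partial>expm 1) = 2"
    using I2 E2 by (simp_all add: power2_eq_square)
  show E: "(\<integral>x. x \<partial>expm 1) = 1"
    using exponential_distributed_expectation[OF _ distributed_expm] by simp
  then show "integrable (expm 1) (\<lambda>x. x)"
    by (metis not_integrable_integral_eq zero_neq_one)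
qed

definition expE :: "(nat \<times> nat \<Rightarrow> real) measure" where
  "expE = Pi\<^sub>M UNIV (\<lambda>_. expm 1)"

lemma prob_space_expE: "prob_space expE"
  unfolding expE_def by (rule prob_space_PiM) (rule prob_space_expm, simp)

lemma expE_component [measurable]: "(\<lambda>\<omega>. \<omega> a) \<in> borel_measurable expE"
proof -
  have "(\<lambda>\<omega>. \<omega> a) \<in> Pi\<^sub>M UNIV (\<lambda>_. expm 1) \<rightarrow>\<^sub>M expm 1"
    by (rule measurable_component_singleton) simp
  then show ?thesis by (simp add: expE_def)
qed

lemma space_expE [simp]: "space expE = UNIV"
  by (simp add: expE_def space_PiM)

lemma distr_expE_component: "distr expE borel (\<lambda>\<omega>. \<omega> a) = expm 1"
proof -
  have "distr expE (expm 1) (\<lambda>\<omega>. \<omega> a) = expm 1"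
    unfolding expE_def by (rule distr_PiM_component) (auto intro: prob_space_expm)
  moreover have "distr expE borel (\<lambda>\<omega>. \<omega> a) = distr expE (expm 1) (\<lambda>\<omega>. \<omega> a)"
    by (rule distr_cong) auto
  ultimately show ?thesis by simp
qed

lemma expE_nonneg: "AE \<omega> in expE. \<forall>a. \<omega> a \<ge> 0"
proof -
  have "AE x in expm 1. (x::real) \<ge> 0"
    by (subst AE_density) (auto simp: exponential_density_def)
  then have "AE x in distr expE borel (\<lambda>\<omega>. \<omega> a). x \<ge> 0" for a
    unfolding distr_expE_component .
  then have "AE \<omega> in expE. \<omega> a \<ge> 0" for a
    by (subst (asm) AE_distr_iff) auto
  then show ?thesis by (simp add: AE_all_countable)
qed

lemma emeasure_expE_cylinder:
  assumes "finite J" "\<And>a. a \<in> J \<Longrightarrow> B a \<in> sets borel"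
  shows "emeasure expE {\<omega>. \<forall>a\<in>J. \<omega> a \<in> B a} = (\<Prod>a\<in>J. emeasure (expm 1) (B a))"
proof -
  have "{\<omega>. \<forall>a\<in>J. \<omega> a \<in> B a} = prod_emb UNIV (\<lambda>_. expm 1) J (Pi\<^sub>E J B)"
    by (auto simp: prod_emb_def space_PiM restrict_def PiE_iff)
  then show ?thesis
    unfolding expE_def using assms by (simp add: emeasure_PiM_emb prob_space_expm)
qed

lemma distr_expE_scale:
  assumes A: "finite A" and \<rho>: "\<And>a. \<rho> a > 0"
  shows "distr expE (Pi\<^sub>M A (\<lambda>_. borel)) (\<lambda>\<omega>. \<lambda>a\<in>A. \<omega> a / \<rho> a) = Pi\<^sub>M A (\<lambda>a. expm (\<rho> a))"
proof -
  interpret product_sigma_finite "\<lambda>a. expm (\<rho> a)"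
    unfolding product_sigma_finite_def
    using \<rho> prob_space_exponential_density prob_space_imp_sigma_finite by blast
  have m: "(\<lambda>\<omega>. \<lambda>a\<in>A. \<omega> a / \<rho> a) \<in> expE \<rightarrow>\<^sub>M Pi\<^sub>M A (\<lambda>_. borel)"
    by measurable
  show ?thesis
  proof (rule PiM_eqI[OF A])
    show "sets (distr expE (Pi\<^sub>M A (\<lambda>_. borel)) (\<lambda>\<omega>. \<lambda>a\<in>A. \<omega> a / \<rho> a)) = sets (Pi\<^sub>M A (\<lambda>a. expm (\<rho> a)))"
      unfolding sets_distr by (rule sets_PiM_cong) auto
  next
    fix B assume "\<And>a. a \<in> A \<Longrightarrow> B a \<in> sets (expm (\<rho> a))"
    then have B [measurable]: "\<And>a. a \<in> A \<Longrightarrow> B a \<in> sets borel" by simp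
    have "emeasure (distr expE (Pi\<^sub>M A (\<lambda>_. borel)) (\<lambda>\<omega>. \<lambda>a\<in>A. \<omega> a / \<rho> a)) (Pi\<^sub>E A B)
        = emeasure expE ((\<lambda>\<omega>. \<lambda>a\<in>A. \<omega> a / \<rho> a) -` Pi\<^sub>E A B \<inter> space expE)"
      using A B by (intro emeasure_distr m sets_PiM_I_finite)
    also have "(\<lambda>\<omega>. \<lambda>a\<in>A. \<omega> a / \<rho> a) -` Pi\<^sub>E A B \<inter> space expE = {\<omega>. \<forall>a\<in>A. \<omega> a \<in> {x. x / \<rho> a \<in> B a}}"
      by (auto simp: PiE_iff)
    also have "emeasure expE \<dots> = (\<Prod>a\<in>A. emeasure (expm 1) {x. x / \<rho> a \<in> B a})"
      using A by (intro emeasure_expE_cylinder) measurable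
    also have "\<dots> = (\<Prod>a\<in>A. emeasure (expm (\<rho> a)) (B a))"
    proof (rule prod.cong[OF refl])
      fix a assume "a \<in> A"
      then show "emeasure (expm 1) {x. x / \<rho> a \<in> B a} = emeasure (expm (\<rho> a)) (B a)"
        using B \<rho> by (subst distr_expm_scale[symmetric]) (auto simp: emeasure_distr vimage_def)
    qed
    finally show "emeasure (distr expE (Pi\<^sub>M A (\<lambda>_. borel)) (\<lambda>\<omega>. \<lambda>a\<in>A. \<omega> a / \<rho> a)) (Pi\<^sub>E A B)
        = (\<Prod>a\<in>A. emeasure (expm (\<rho> a)) (B a))" .
  qed
qed

lemma expE_component_integral:
  fixes f :: "real \<Rightarrow> real"
  assumes "f \<in> borel_measurable borel"
  shows "integrable expE (\<lambda>\<omega>. f (\<omega> a)) \<longleftrightarrow> integrable (expm 1) f"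
    and "(\<integral>\<omega>. f (\<omega> a) \<partial>expE) = (\<integral>x. f x \<partial>expm 1)"
  using integrable_distr_eq[OF expE_component assms, of a] integral_distr[OF expE_component assms, of a]
  unfolding distr_expE_component by (simp only:)+

lemma expE_moments:
  shows "integrable expE (\<lambda>\<omega>. \<omega> a)" "(\<integral>\<omega>. \<omega> a \<partial>expE) = 1"
    "integrable expE (\<lambda>\<omega>. \<omega> a * \<omega> a)" "(\<integral>\<omega>. \<omega> a * \<omega> a \<partial>expE) = 2"
proof -
  have m: "(\<lambda>x::real. x) \<in> borel_measurable borel" "(\<lambda>x::real. x * x) \<in> borel_measurable borel"
    by measurable
  show "integrable expE (\<lambda>\<omega>. \<omega> a)" "(\<integral>\<omega>. \<omega> a \<partial>expE) = 1"
    "integrable expE (\<lambda>\<omega>. \<omega> a * \<omega> a)" "(\<integral>\<omega>. \<omega> a * \<omega> a \<partial>expE) = 2"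
    using expm_int expm_mean expm_square
    unfolding expE_component_integral[OF m(1), of a] expE_component_integral[OF m(2), of a]
    by - assumption+
qed

lemma expE_pair_moment:
  assumes "a \<noteq> b"
  shows "integrable expE (\<lambda>\<omega>. \<omega> a * \<omega> b)" "(\<integral>\<omega>. \<omega> a * \<omega> b \<partial>expE) = 1"
proof -
  interpret E: prob_space expE by (rule prob_space_expE)
  have 1: "E.indep_vars (\<lambda>_. borel) (\<lambda>a \<omega>. \<omega> a) {a, b}"
  proof (subst E.indep_vars_iff_distr_eq_PiM')
    show "distr expE (Pi\<^sub>M {a, b} (\<lambda>_. borel)) (\<lambda>x. \<lambda>i\<in>{a, b}. x i)
      = Pi\<^sub>M {a, b} (\<lambda>i. distr expE borel (\<lambda>\<omega>. \<omega> i))"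
      using distr_expE_scale[of "{a, b}" "\<lambda>_. 1"] unfolding distr_expE_component by simp
  qed auto
  show "integrable expE (\<lambda>\<omega>. \<omega> a * \<omega> b)"
    using E.indep_vars_integrable[OF _ 1] assms expE_moments(1) by simp
  show "(\<integral>\<omega>. \<omega> a * \<omega> b \<partial>expE) = 1"
    using E.indep_vars_lebesgue_integral[OF _ 1] assms expE_moments(1,2) by simp
qed

section \<open>Random rates and the Burke weights\<close>

lemma lpp_cong:
  assumes "\<And>i j. i \<le> k \<Longrightarrow> j \<le> l \<Longrightarrow> w (i, j) = w' (i, j)"
  shows "lpp w k l = lpp w' k l"
  using assms
proof (induction w k l rule: lpp.induct)
  case (4 w i j)
  have "lpp w i (Suc j) = lpp w' i (Suc j)" "lpp w (Suc i) j = lpp w' (Suc i) j"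
    by (rule 4; use 4(3) in auto)+
  then show ?case using 4(3) by simp
qed auto

(* Row j of the model is row j + 1 here, the axes being the extra boundary. The entry at (0, 0) is
   junk: the recursion never reads it. *)
definition burke_rates :: "real \<Rightarrow> (nat \<Rightarrow> real) \<Rightarrow> nat \<times> nat \<Rightarrow> real" where
  "burke_rates z r = (\<lambda>(i, j). if j = 0 then z else if i = 0 then r (j - 1) - z else r (j - 1))"

definition burke_weights :: "real \<Rightarrow> (nat \<Rightarrow> real) \<Rightarrow> (nat \<times> nat \<Rightarrow> real) \<Rightarrow> nat \<times> nat \<Rightarrow> real" where
  "burke_weights z r \<omega> = (\<lambda>a. \<omega> a / burke_rates z r a)"

lemma burke_weights_simps [simp]:
  "burke_weights z r \<omega> (i, 0) = \<omega> (i, 0) / z"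
  "burke_weights z r \<omega> (0, Suc j) = \<omega> (0, Suc j) / (r j - z)"
  "burke_weights z r \<omega> (Suc i, Suc j) = \<omega> (Suc i, Suc j) / r j"
  by (simp_all add: burke_weights_def burke_rates_def)

text \<open>The Burke property for frozen rates. Its rate condition holds because
  \<open>z + (r j - z) = r j\<close>; the recursion reads only the rectangle \<open>A\<close>, so a
  finite product law suffices.\<close>

lemma distr_burke_weights:
  fixes z :: real
  assumes "z > 0" and r: "\<And>j. r j > z"
  shows "distr expE borel (\<lambda>\<omega>. lpp (burke_weights z r \<omega>) k l - lpp (burke_weights z r \<omega>) k 0)
    = distr expE borel (\<lambda>\<omega>. \<Sum>j<l. \<omega> (0, Suc j) / (r j - z))"
proof -
  define A where "A = {..k} \<times> {..l}"
  let ?\<rho> = "burke_rates z r"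
  let ?R = "\<lambda>\<omega>. \<lambda>a\<in>A. \<omega> a / ?\<rho> a"
  have r0: "r j > 0" for j using r[of j] \<open>z > 0\<close> by simp
  have \<rho>: "?\<rho> a > 0" for a
    using \<open>z > 0\<close> r r0 by (cases a) (simp add: burke_rates_def)
  have sum: "?\<rho> (Suc i, Suc j) = ?\<rho> (Suc i, 0) + ?\<rho> (0, Suc j)" for i j
    by (simp add: burke_rates_def)
  have fin: "finite A" by (simp add: A_def)
  have mR: "?R \<in> expE \<rightarrow>\<^sub>M Pi\<^sub>M A (\<lambda>_. borel)"
    by measurable
  have comp: "distr expE borel (\<lambda>\<omega>. F (?R \<omega>)) = distr (Pi\<^sub>M A (\<lambda>a. expm (?\<rho> a))) borel F"
    if F: "F \<in> borel_measurable (Pi\<^sub>M A (\<lambda>_. borel))" for F :: "(nat \<times> nat \<Rightarrow> real) \<Rightarrow> real"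
    using distr_distr[OF F mR] by (simp add: distr_expE_scale[OF fin \<rho>] comp_def)
  \<comment> \<open>\<open>measurable_lpp\<close> asks for measurability of every coordinate;
    outside \<open>A\<close>, where \<open>lpp y k l\<close> never looks, the coordinates are
    replaced by 0.\<close>
  define w where "w y = (\<lambda>a. if a \<in> A then y a else 0)" for y :: "nat \<times> nat \<Rightarrow> real"
  have mw: "(\<lambda>y. w y a) \<in> borel_measurable (Pi\<^sub>M A (\<lambda>_. borel))" for a
    by (cases "a \<in> A") (auto simp: w_def intro: measurable_component_singleton)
  have Gw: "lpp y k l = lpp (w y) k l" "lpp y k 0 = lpp (w y) k 0" for y
    by (rule lpp_cong; simp add: w_def A_def)+
  have "distr expE borel (\<lambda>\<omega>. lpp (burke_weights z r \<omega>) k l - lpp (burke_weights z r \<omega>) k 0)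
      = distr expE borel (\<lambda>\<omega>. lpp (?R \<omega>) k l - lpp (?R \<omega>) k 0)"
  proof -
    have "lpp (burke_weights z r \<omega>) k l = lpp (?R \<omega>) k l" "lpp (burke_weights z r \<omega>) k 0 = lpp (?R \<omega>) k 0" for \<omega>
      by (rule lpp_cong; simp add: burke_weights_def A_def)+
    then show ?thesis by simp
  qed
  also have "\<dots> = distr (Pi\<^sub>M A (\<lambda>a. expm (?\<rho> a))) borel (\<lambda>y. lpp y k l - lpp y k 0)"
  proof (rule comp)
    have "(\<lambda>y. lpp (w y) k l - lpp (w y) k 0) \<in> borel_measurable (Pi\<^sub>M A (\<lambda>_. borel))"
      by (intro borel_measurable_diff measurable_lpp mw)
    then show "(\<lambda>y. lpp y k l - lpp y k 0) \<in> borel_measurable (Pi\<^sub>M A (\<lambda>_. borel))"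
      unfolding Gw[symmetric] .
  qed
  also have "\<dots> = distr (Pi\<^sub>M A (\<lambda>a. expm (?\<rho> a))) borel (\<lambda>y. \<Sum>j<l. y (0, Suc j))"
    unfolding A_def by (rule burke_column[OF \<rho> sum])
  also have "\<dots> = distr expE borel (\<lambda>\<omega>. \<Sum>j<l. ?R \<omega> (0, Suc j))"
    by (rule comp[symmetric]) (auto intro!: borel_measurable_sum measurable_component_singleton simp: A_def)
  also have "\<dots> = distr expE borel (\<lambda>\<omega>. \<Sum>j<l. \<omega> (0, Suc j) / (r j - z))"
    by (intro arg_cong[where f = "distr expE borel"] ext sum.cong) (auto simp: A_def burke_rates_def)
  finally show ?thesis .
qed

section \<open>The random rates and the coupled model on a product space\<close>

locale random_rates = prob_space M for M :: "'a measure" +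
  fixes \<xi> :: "nat \<Rightarrow> 'a \<Rightarrow> real" and m :: "real measure" and c :: real
  assumes c_pos: "c > 0"
    and indep: "indep_vars (\<lambda>_. borel) \<xi> UNIV"
    and law: "\<And>j. distr M borel (\<xi> j) = m"
begin

lemma measurable_\<xi> [measurable]: "\<xi> j \<in> borel_measurable M"
  using indep by (auto simp: indep_vars_def)

lemma sets_m [measurable_cong]: "sets m = sets borel"
  using law[of 0, symmetric] by simp

lemma prob_space_m: "prob_space m"
  using law[of 0] prob_space_distr[of "\<xi> 0" borel] by simp

(* Clamping makes every rate at least c everywhere; almost surely it changes nothing. *)
definition rate :: "nat \<Rightarrow> 'a \<Rightarrow> real" where
  "rate j w = max c (\<xi> j w)"

lemma rate_ge: "rate j w \<ge> c"
  by (simp add: rate_def)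

lemma measurable_rate [measurable]: "rate j \<in> borel_measurable M"
  unfolding rate_def by measurable

text \<open>The rates keep their original space and the unit exponentials form an independent
  factor, so that conditioning on the rates turns into Fubini.\<close>

definition env :: "('a \<times> (nat \<times> nat \<Rightarrow> real)) measure" where
  "env = M \<Otimes>\<^sub>M expE"

sublocale E: prob_space expE
  by (rule prob_space_expE)

sublocale ME: pair_prob_space M expE ..

lemma prob_space_env: "prob_space env"
  unfolding env_def by (rule ME.prob_space_axioms)

sublocale env: prob_space env
  by (rule prob_space_env)

lemma env_measurable [measurable (raw)]:
  "(\<lambda>x. snd x a) \<in> borel_measurable env"
  "f \<in> M \<rightarrow>\<^sub>M L \<Longrightarrow> (\<lambda>x. f (fst x)) \<in> env \<rightarrow>\<^sub>M L"
  unfolding env_def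
  by (rule measurable_compose[OF measurable_snd expE_component], rule measurable_compose[OF measurable_fst])

lemma distr_env_snd: "distr env expE snd = expE"
proof (rule measure_eqI)
  fix A assume "A \<in> sets (distr env expE snd)"
  then have A: "A \<in> sets expE" by simp
  then have "emeasure (distr env expE snd) A = emeasure (M \<Otimes>\<^sub>M expE) (space M \<times> A)"
    using sets.sets_into_space[OF A]
    by (auto simp: env_def emeasure_distr space_pair_measure intro!: arg_cong2[where f = emeasure])
  also have "\<dots> = emeasure expE A"
    using A by (simp add: E.emeasure_pair_measure_Times emeasure_space_1)
  finally show "emeasure (distr env expE snd) A = emeasure expE A" .
qed simp

lemma env_nonneg: "AE u in env. \<forall>a. snd u a \<ge> 0"
proof (rule AE_distrD[of snd env expE])
  show "snd \<in> env \<rightarrow>\<^sub>M expE" by (simp add: env_def)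
  show "AE \<omega> in distr env expE snd. \<forall>a. \<omega> a \<ge> 0"
    unfolding distr_env_snd by (rule expE_nonneg)
qed

lemma env_product_integral:
  fixes f :: "'a \<Rightarrow> real" and g :: "(nat \<times> nat \<Rightarrow> real) \<Rightarrow> real"
  assumes f: "integrable M f" and g: "integrable expE g"
  shows "integrable env (\<lambda>x. g (snd x) * f (fst x))"
    "(\<integral>x. g (snd x) * f (fst x) \<partial>env) = (\<integral>\<omega>. g \<omega> \<partial>expE) * (\<integral>w. f w \<partial>M)"
proof -
  have [measurable]: "f \<in> borel_measurable M" "g \<in> borel_measurable expE"
    using f g by auto
  have "integrable (M \<Otimes>\<^sub>M expE) (\<lambda>x. g (snd x) * f (fst x))"
  proof (rule ME.Fubini_integrable)
    have "(\<lambda>w. \<integral>\<omega>. norm (g (snd (w, \<omega>)) * f (fst (w, \<omega>))) \<partial>expE)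
        = (\<lambda>w. (\<integral>\<omega>. \<bar>g \<omega>\<bar> \<partial>expE) * \<bar>f w\<bar>)"
      using g by (simp add: abs_mult)
    then show "integrable M (\<lambda>w. \<integral>\<omega>. norm (g (snd (w, \<omega>)) * f (fst (w, \<omega>))) \<partial>expE)"
      using f by simp
    show "AE w in M. integrable expE (\<lambda>\<omega>. g (snd (w, \<omega>)) * f (fst (w, \<omega>)))"
      using g by simp
  qed measurable
  then show "integrable env (\<lambda>x. g (snd x) * f (fst x))"
    "(\<integral>x. g (snd x) * f (fst x) \<partial>env) = (\<integral>\<omega>. g \<omega> \<partial>expE) * (\<integral>w. f w \<partial>M)"
    using ME.integral_fst'[of "\<lambda>x. g (snd x) * f (fst x)"] g by (simp_all add: env_def)
qed

lemma integral_rates_pair: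
  fixes g :: "real \<Rightarrow> real"
  assumes [measurable]: "g \<in> borel_measurable borel" and B: "\<And>r. \<bar>g r\<bar> \<le> B"
  shows "integrable M (\<lambda>w. g (\<xi> j w))" "(\<integral>w. g (\<xi> j w) \<partial>M) = (\<integral>r. g r \<partial>m)"
    "integrable M (\<lambda>w. g (\<xi> i w) * g (\<xi> j w))"
    "i \<noteq> j \<Longrightarrow> (\<integral>w. g (\<xi> i w) * g (\<xi> j w) \<partial>M) = (\<integral>r. g r \<partial>m)\<^sup>2"
    "(\<integral>w. g (\<xi> j w) * g (\<xi> j w) \<partial>M) \<le> B\<^sup>2"
proof -
  have int: "integrable M (\<lambda>w. g (\<xi> j w))" for j
    by (rule integrable_const_bound[of _ B]) (use B in auto)
  have exp: "(\<integral>w. g (\<xi> j w) \<partial>M) = (\<integral>r. g r \<partial>m)" for j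
    unfolding law[of j, symmetric] by (subst integral_distr) auto
  have bd: "\<bar>g x * g y\<bar> \<le> B\<^sup>2" for x y
    using mult_mono[OF B[of x] B[of y]] B[of x] by (simp add: abs_mult power2_eq_square)
  show int2: "integrable M (\<lambda>w. g (\<xi> i w) * g (\<xi> j w))" for i j
    by (rule integrable_const_bound[of _ "B\<^sup>2"]) (use bd in auto)
  show "integrable M (\<lambda>w. g (\<xi> j w))" "(\<integral>w. g (\<xi> j w) \<partial>M) = (\<integral>r. g r \<partial>m)"
    by (rule int exp)+
  show "(\<integral>w. g (\<xi> j w) * g (\<xi> j w) \<partial>M) \<le> B\<^sup>2"
    using bd by (intro integral_le_const int2 AE_I2) (simp add: abs_le_iff)
  assume "i \<noteq> j"
  have ind: "indep_vars (\<lambda>_. borel) (\<lambda>j w. g (\<xi> j w)) {i, j}"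
    by (rule indep_vars_compose2[OF indep_vars_subset[OF indep]]) auto
  have "(\<integral>w. (\<Prod>k\<in>{i, j}. g (\<xi> k w)) \<partial>M) = (\<Prod>k\<in>{i, j}. \<integral>w. g (\<xi> k w) \<partial>M)"
    by (rule indep_vars_lebesgue_integral[OF _ ind]) (use int in auto)
  then show "(\<integral>w. g (\<xi> i w) * g (\<xi> j w) \<partial>M) = (\<integral>r. g r \<partial>m)\<^sup>2"
    using \<open>i \<noteq> j\<close> by (simp add: exp power2_eq_square)
qed

text \<open>Exponentials and rates are independent, so means and mixed moments factor and distinct
  terms are uncorrelated. The 2 in \<open>2 * B\<^sup>2\<close> is the second moment of a unit
  exponential. The map \<open>a\<close> selects the exponentials of one axis.\<close>

lemma plim_weighted_exponentials:
  fixes g :: "real \<Rightarrow> real" and a :: "nat \<Rightarrow> nat \<times> nat"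
  assumes g [measurable]: "g \<in> borel_measurable borel" and B: "\<And>r. \<bar>g r\<bar> \<le> B"
    and a: "inj a" and k: "(\<lambda>n. real (k n) / real n) \<longlonglongrightarrow> \<theta>"
  shows "plim env (\<lambda>n x. (\<Sum>j<k n. snd x (a j) * g (\<xi> j (fst x))) / real n) (\<theta> * (\<integral>r. g r \<partial>m))"
proof (rule env.plim_uncorrelated_mean[OF _ _ _ _ _ _ k, where K = "2 * B\<^sup>2"])
  note rates = integral_rates_pair[OF g B]
  show "(\<lambda>x. snd x (a j) * g (\<xi> j (fst x))) \<in> borel_measurable env" for j
    by measurable
  show "integrable env (\<lambda>x. snd x (a j) * g (\<xi> j (fst x)))"
    "(\<integral>x. snd x (a j) * g (\<xi> j (fst x)) \<partial>env) = (\<integral>r. g r \<partial>m)" for j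
    using env_product_integral[OF rates(1)[of j] expE_moments(1)[of "a j"]] rates(2)[of j] expE_moments(2)[of "a j"]
    by auto
  have 2: "integrable expE (\<lambda>\<omega>. \<omega> (a i) * \<omega> (a j))" for i j
    by (cases "i = j") (use a expE_moments expE_pair_moment in \<open>auto simp: inj_eq\<close>)
  note p = env_product_integral[OF rates(3) 2]
  show "integrable env (\<lambda>x. snd x (a i) * g (\<xi> i (fst x)) * (snd x (a j) * g (\<xi> j (fst x))))" for i j
    using p(1)[of i j i j] by (simp add: mult_ac)
  show "(\<integral>x. snd x (a i) * g (\<xi> i (fst x)) * (snd x (a j) * g (\<xi> j (fst x))) \<partial>env) = (\<integral>r. g r \<partial>m)\<^sup>2"
    if "i \<noteq> j" for i j
    using p(2)[of i j i j] rates(4)[OF that] expE_pair_moment(2)[of "a i" "a j"] a that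
    by (simp add: mult_ac inj_eq)
  show "(\<integral>x. snd x (a j) * g (\<xi> j (fst x)) * (snd x (a j) * g (\<xi> j (fst x))) \<partial>env) \<le> 2 * B\<^sup>2" for j
    using p(2)[of j j j j] rates(5)[of j] expE_moments(4)[of "a j"] by (simp add: mult_ac)
qed

text \<open>The expectation of 1/(\<xi> - z), with the rate clamped at \<open>c\<close> so that the
  integrand is bounded by \<open>1 / (c - z)\<close> everywhere when \<open>z < c\<close>.\<close>

definition \<kappa> :: "real \<Rightarrow> real" where
  "\<kappa> z = (\<integral>r. 1 / (max c r - z) \<partial>m)"

lemma plim_row:
  assumes "(\<lambda>n. real (k n) / real n) \<longlonglongrightarrow> \<theta>"
  shows "plim env (\<lambda>n x. (\<Sum>i<k n. snd x (Suc i, 0) / z) / real n) (\<theta> * (1 / z))"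
  using plim_weighted_exponentials[of "\<lambda>_. 1 / z" "\<bar>1 / z\<bar>" "\<lambda>i. (Suc i, 0)", OF _ _ _ assms]
    prob_space.prob_space[OF prob_space_m]
  by (simp add: inj_on_def)

lemma plim_col:
  assumes z: "0 < z" "z < c" and k: "(\<lambda>n. real (k n) / real n) \<longlonglongrightarrow> \<theta>"
  shows "plim env (\<lambda>n x. (\<Sum>j<k n. snd x (0, Suc j) / (rate j (fst x) - z)) / real n) (\<theta> * \<kappa> z)"
proof -
  have "\<bar>1 / (max c r - z)\<bar> \<le> 1 / (c - z)" for r
    using z by (auto simp: abs_of_pos intro!: divide_left_mono mult_pos_pos)
  then have "plim env (\<lambda>n x. (\<Sum>j<k n. snd x (0, Suc j) * (1 / (max c (\<xi> j (fst x)) - z))) / real n)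
      (\<theta> * (\<integral>r. 1 / (max c r - z) \<partial>m))"
    using plim_weighted_exponentials[of "\<lambda>r. 1 / (max c r - z)" "1 / (c - z)" "\<lambda>j. (0, Suc j)", OF _ _ _ k]
    by (simp add: inj_on_def)
  then show ?thesis by (simp add: \<kappa>_def rate_def)
qed

lemma measurable_burke_lpp [measurable (raw)]:
  "(\<lambda>x. lpp (burke_weights z (\<lambda>j. rate j (fst x)) (snd x)) k l) \<in> borel_measurable env"
proof (rule measurable_lpp)
  fix a :: "nat \<times> nat"
  show "(\<lambda>x. burke_weights z (\<lambda>j. rate j (fst x)) (snd x) a) \<in> borel_measurable env"
    unfolding burke_weights_def burke_rates_def
    by (cases a; cases "snd a = 0"; cases "fst a = 0") (auto intro!: borel_measurable_divide)
qed

text \<open>For every fixed environment the two sections have the same law by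
  \<open>distr_burke_weights\<close>; integrating over the environment gives the claim.\<close>

lemma env_burke:
  assumes z: "0 < z" "z < c"
  shows "distr env borel (\<lambda>x. lpp (burke_weights z (\<lambda>j. rate j (fst x)) (snd x)) k l
        - lpp (burke_weights z (\<lambda>j. rate j (fst x)) (snd x)) k 0)
    = distr env borel (\<lambda>x. \<Sum>j<l. snd x (0, Suc j) / (rate j (fst x) - z))"
    (is "distr env borel ?F = distr env borel ?H")
proof (rule measure_eqI)
  fix B assume "B \<in> sets (distr env borel ?F)"
  then have B [measurable]: "B \<in> sets borel" by simp
  have mF: "?F \<in> borel_measurable env" and mH: "?H \<in> borel_measurable env"
    by measurable
  have em: "emeasure (distr env borel U) B = (\<integral>\<^sup>+w. emeasure (distr expE borel (\<lambda>\<omega>. U (w, \<omega>))) B \<partial>M)"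
    if U: "U \<in> borel_measurable env" for U
  proof -
    have [measurable]: "U \<in> borel_measurable (M \<Otimes>\<^sub>M expE)" using U by (simp add: env_def)
    have "emeasure (distr env borel U) B = emeasure (M \<Otimes>\<^sub>M expE) (U -` B \<inter> space (M \<Otimes>\<^sub>M expE))"
      using U by (simp add: emeasure_distr env_def)
    also have "\<dots> = (\<integral>\<^sup>+w. emeasure expE (Pair w -` (U -` B \<inter> space (M \<Otimes>\<^sub>M expE))) \<partial>M)"
      by (rule E.emeasure_pair_measure_alt) measurable
    also have "\<dots> = (\<integral>\<^sup>+w. emeasure (distr expE borel (\<lambda>\<omega>. U (w, \<omega>))) B \<partial>M)"
    proof (rule nn_integral_cong)
      fix w assume w: "w \<in> space M"
      then have [measurable]: "(\<lambda>\<omega>. U (w, \<omega>)) \<in> borel_measurable expE" by measurable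
      show "emeasure expE (Pair w -` (U -` B \<inter> space (M \<Otimes>\<^sub>M expE)))
          = emeasure (distr expE borel (\<lambda>\<omega>. U (w, \<omega>))) B"
        using w by (subst emeasure_distr) (auto simp: space_pair_measure intro!: arg_cong[where f = "emeasure expE"])
    qed
    finally show ?thesis .
  qed
  have "rate j w > z" for j w using rate_ge[of j w] z by simp
  then have "distr expE borel (\<lambda>\<omega>. ?F (w, \<omega>)) = distr expE borel (\<lambda>\<omega>. ?H (w, \<omega>))" for w
    using distr_burke_weights[of z "\<lambda>j. rate j w" k l] z by simp
  then show "emeasure (distr env borel ?F) B = emeasure (distr env borel ?H) B"
    unfolding em[OF mF] em[OF mH] by simp
qed simp

text \<open>Split at the corner \<open>(k n, 0)\<close>. The axis up to it contributes
  \<open>x / z\<close>; the climb along column \<open>k n\<close> has the law of the left axis and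
  contributes \<open>y * \<kappa> z\<close>.\<close>

lemma plim_burke_lpp:
  assumes z: "0 < z" "z < c" and k: "(\<lambda>n. real (k n) / real n) \<longlonglongrightarrow> x" and l: "(\<lambda>n. real (l n) / real n) \<longlonglongrightarrow> y"
  shows "plim env (\<lambda>n u. lpp (burke_weights z (\<lambda>j. rate j (fst u)) (snd u)) (k n) (l n) / real n) (x / z + y * \<kappa> z)"
proof -
  let ?lpp = "\<lambda>k l u. lpp (burke_weights z (\<lambda>j. rate j (fst u)) (snd u)) k l"
  have 1: "plim env (\<lambda>n u. ?lpp (k n) 0 u / real n) (x / z)"
    using plim_row[OF k, of z] by (simp add: lpp_row)
  have "plim env (\<lambda>n u. (?lpp (k n) (l n) u - ?lpp (k n) 0 u) / real n) (y * \<kappa> z)"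
  proof (rule plim_distr_cong[OF plim_col[OF z l]])
    fix n
    let ?H = "\<lambda>u. \<Sum>j<l n. snd u (0, Suc j) / (rate j (fst u) - z)"
    show "(\<lambda>u. (?lpp (k n) (l n) u - ?lpp (k n) 0 u) / real n) \<in> borel_measurable env"
      by measurable
    have d: "(\<lambda>t. t / real n) \<in> borel_measurable borel" by measurable
    have "distr env borel (\<lambda>u. U u / real n) = distr (distr env borel U) borel (\<lambda>t. t / real n)"
      if "U \<in> borel_measurable env" for U
      using distr_distr[OF d that] by (simp add: comp_def)
    then show "distr env borel (\<lambda>u. (?lpp (k n) (l n) u - ?lpp (k n) 0 u) / real n) = distr env borel (\<lambda>u. ?H u / real n)"
      by (simp add: env_burke[OF z])
  qed
  from env.plim_add[OF this 1] show ?thesis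
    by (simp add: add.commute flip: add_divide_distrib)
qed

text \<open>Disposes of the endpoint weight that separates \<open>last_passage\<close> from
  \<open>lpp\<close>. The site moves with \<open>n\<close>, but all sites have one law, and at a
  fixed site the convergence is pathwise.\<close>

lemma plim_single_weight: "plim env (\<lambda>n u. snd u (a n) / c / real n) 0"
proof (rule plim_distr_cong)
  show "plim env (\<lambda>n u. snd u (0, 0) / c / real n) 0"
  proof (rule env.plim_AE)
    have "(\<lambda>n. t / c * (1 / real n)) \<longlonglongrightarrow> t / c * 0" for t
      by (intro tendsto_mult tendsto_const lim_1_over_n)
    then have "(\<lambda>n. t / c / real n) \<longlonglongrightarrow> 0" for t
      by simp
    then show "AE u in env. (\<lambda>n. snd u (0, 0) / c / real n) \<longlonglongrightarrow> 0"
      by (intro always_eventually allI)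
  qed measurable
next
  fix n
  show "(\<lambda>u. snd u (a n) / c / real n) \<in> borel_measurable env" by measurable
  have d: "(\<lambda>t. t / c / real n) \<in> borel_measurable borel" by measurable
  have "distr env borel (\<lambda>u. snd u b / c / real n) = distr (expm 1) borel (\<lambda>t. t / c / real n)" for b
  proof -
    have s: "(\<lambda>u. snd u b) \<in> borel_measurable env" and s': "snd \<in> M \<Otimes>\<^sub>M expE \<rightarrow>\<^sub>M expE"
      by measurable
    have "distr env borel (\<lambda>u. snd u b) = distr (distr env expE snd) borel (\<lambda>\<omega>. \<omega> b)"
      using distr_distr[OF expE_component[of b] s'] by (simp only: comp_def env_def)
    also have "distr env expE snd = expE"
      by (rule distr_env_snd)
    finally have "distr env borel (\<lambda>u. snd u b) = expm 1"
      unfolding distr_expE_component .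
    then show ?thesis
      using distr_distr[OF d s] by (simp only: comp_def)
  qed
  then show "distr env borel (\<lambda>u. snd u (a n) / c / real n) = distr env borel (\<lambda>u. snd u (0, 0) / c / real n)"
    by (simp only:)
qed

end

section \<open>The law of the weights\<close>

text \<open>For \<open>r > 0\<close> the exponential law of rate \<open>r\<close>, as a function of
  the rate. The scaling form matches the coupled weights and makes measurability in \<open>r\<close>
  a statement about sections of a product set.\<close>

definition expQ :: "real set \<Rightarrow> real \<Rightarrow> real" where
  "expQ B r = measure (expm 1) {e. e / r \<in> B}"

lemma emeasure_expm_finite: "emeasure (expm 1) A \<noteq> \<infinity>"
proof -
  interpret prob_space "expm 1" by (rule prob_space_expm) simp
  show ?thesis by simp
qed

lemma emeasure_expm_eq: "emeasure (expm 1) {e. e / r \<in> B} = ennreal (expQ B r)"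
  unfolding expQ_def using emeasure_expm_finite by (simp add: emeasure_eq_ennreal_measure)

lemma expQ_bounds: "0 \<le> expQ B r" "expQ B r \<le> 1"
proof -
  interpret prob_space "expm 1" by (rule prob_space_expm) simp
  show "0 \<le> expQ B r" "expQ B r \<le> 1" by (simp_all add: expQ_def)
qed

lemma measurable_expQ [measurable]:
  assumes [measurable]: "B \<in> sets borel"
  shows "expQ B \<in> borel_measurable borel"
proof -
  interpret prob_space "expm 1" by (rule prob_space_expm) simp
  have "{p \<in> space (borel \<Otimes>\<^sub>M expm 1). snd p / fst p \<in> B} \<in> sets (borel \<Otimes>\<^sub>M expm 1)"
    by measurable
  then have "(\<lambda>r. emeasure (expm 1) (Pair r -` {p \<in> space (borel \<Otimes>\<^sub>M expm 1). snd p / fst p \<in> B})) \<in> borel_measurable borel"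
    by (rule measurable_emeasure_Pair)
  then have "(\<lambda>r. emeasure (expm 1) {e. e / r \<in> B}) \<in> borel_measurable borel"
    by (simp add: space_pair_measure vimage_def)
  then show ?thesis
    unfolding expQ_def measure_def by measurable
qed

lemma expQ_atMost:
  assumes "r > 0"
  shows "expQ {..x} r = (if x > 0 then exp_cdf r x else 0)"
proof -
  interpret prob_space "expm 1" by (rule prob_space_expm) simp
  have eq: "{e. e / r \<in> {..x}} = {e \<in> space (expm 1). e \<le> x * r}"
    using assms by (auto simp: pos_divide_le_eq)
  have D: "expQ {..x} r = 1 - exp (- (x * r) * 1)" if "x \<ge> 0"
    unfolding expQ_def eq using that assms
    by (intro exponential_distributedD_le[OF distributed_expm]) auto
  show ?thesis
  proof (cases "x > 0")
    case True
    then show ?thesis using D by (simp add: exp_cdf_def mult.commute)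
  next
    case False
    have "expQ {..x} r \<le> expQ {..0} r"
      unfolding expQ_def using assms False
      by (intro finite_measure_mono) (auto intro: order_trans[of _ x])
    also have "\<dots> = 0"
      using exponential_distributedD_le[OF distributed_expm, of 0] assms unfolding expQ_def
      by (simp add: pos_divide_le_eq)
    finally show ?thesis using False expQ_bounds(1)[of "{..x}" r] by simp
  qed
qed

text \<open>The weights are specified only through arguments \<open>x > 0\<close>. Right continuity
  at 0 carries equality to 0, where the value is 0; monotonicity then settles the negative
  arguments.\<close>

lemma cdf_eqI_pos:
  assumes "finite_borel_measure P" "finite_borel_measure Q"
    and pos: "\<And>x. x > 0 \<Longrightarrow> cdf P x = cdf Q x" and Q0: "cdf Q 0 = 0"
  shows "P = Q"
proof -
  interpret P: finite_borel_measure P by fact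
  interpret Q: finite_borel_measure Q by fact
  have "((\<lambda>x. cdf P x) \<longlongrightarrow> cdf P 0) (at_right 0)" "((\<lambda>x. cdf Q x) \<longlongrightarrow> cdf Q 0) (at_right 0)"
    using P.cdf_is_right_cont[of 0] Q.cdf_is_right_cont[of 0] by (auto simp: continuous_within)
  moreover have "eventually (\<lambda>x. cdf Q x = cdf P x) (at_right 0)"
    unfolding eventually_at_right_field using pos by (intro exI[of _ 1]) auto
  ultimately have "((\<lambda>x. cdf P x) \<longlongrightarrow> cdf Q 0) (at_right 0)"
    using tendsto_cong by fastforce
  with \<open>((\<lambda>x. cdf P x) \<longlongrightarrow> cdf P 0) (at_right 0)\<close> have P0: "cdf P 0 = 0"
    using tendsto_unique[OF trivial_limit_at_right_real] Q0 by metis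
  show ?thesis
  proof (rule cdf_unique')
    show "cdf P = cdf Q"
    proof
      fix x
      show "cdf P x = cdf Q x"
      proof (cases "x > 0")
        case False
        then have "cdf P x \<le> 0" "cdf Q x \<le> 0"
          using P.cdf_nondecreasing[of x 0] Q.cdf_nondecreasing[of x 0] P0 Q0 by auto
        then show ?thesis using P.cdf_nonneg[of x] Q.cdf_nonneg[of x] by simp
      qed (rule pos)
    qed
  qed fact+
qed

context random_rates
begin

lemma sequence_measurable: "(\<lambda>w j. \<xi> j w) \<in> M \<rightarrow>\<^sub>M Pi\<^sub>M UNIV (\<lambda>_. borel)"
  by (rule measurable_PiM_single') (auto simp: space_PiM)

lemma subalgebra_env: "subalgebra M (env_algebra M \<xi>)"
  unfolding subalgebra_def env_algebra_def
proof
  show "sets (vimage_algebra (space M) (\<lambda>w j. \<xi> j w) (Pi\<^sub>M UNIV (\<lambda>_. borel))) \<subseteq> sets M"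
    using sequence_measurable by (subst sets_vimage_algebra2) (auto simp: measurable_def)
qed simp

sublocale cond: finite_measure_subalgebra M "env_algebra M \<xi>"
  by unfold_locales (rule subalgebra_env)

lemma \<xi>_env_measurable [measurable]: "\<xi> j \<in> borel_measurable (env_algebra M \<xi>)"
proof -
  have "(\<lambda>w j. \<xi> j w) \<in> env_algebra M \<xi> \<rightarrow>\<^sub>M Pi\<^sub>M UNIV (\<lambda>_. borel)"
    unfolding env_algebra_def by (rule measurable_vimage_algebra1) (auto simp: space_PiM)
  then show ?thesis by measurable
qed

lemma rate_env_measurable [measurable]: "rate j \<in> borel_measurable (env_algebra M \<xi>)"
  unfolding rate_def by measurable

lemma rate_eq_\<xi>:
  assumes "AE r in m. c \<le> r"
  shows "AE w in M. rate j w = \<xi> j w"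
proof -
  have "AE r in distr M borel (\<xi> j). c \<le> r" using assms unfolding law .
  then have "AE w in M. c \<le> \<xi> j w" by (rule AE_distrD[rotated]) simp
  then show ?thesis by eventually_elim (simp add: rate_def)
qed

text \<open>For an event \<open>C\<close> of the rate algebra, \<open>P\<close> is the law of the
  weight restricted to \<open>C\<close> and \<open>Q\<close> its counterpart with an independent
  exponential. Their distribution functions agree at each positive argument, hence
  \<open>P = Q\<close> on all Borel sets. Integrating over \<open>C\<close> first avoids null sets
  that depend on the argument \<open>x\<close>.\<close>

lemma cond_prob_single:
  assumes lower: "AE r in m. c \<le> r" and X: "exp_weights_given M \<xi> X" and B [measurable]: "B \<in> sets borel"
  shows "AE w in M. cond_prob_given M (env_algebra M \<xi>) {w \<in> space M. X (i, j) w \<in> B} w = expQ B (rate j w)"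
  unfolding cond_prob_given_def
proof (rule cond.real_cond_exp_charact)
  have mX [measurable]: "X z \<in> borel_measurable M" for z
    using X unfolding exp_weights_given_def by blast
  show "integrable M (indicator {w \<in> space M. X (i, j) w \<in> B} :: _ \<Rightarrow> real)"
    by (intro integrable_real_indicator) (auto simp: emeasure_eq_measure)
  show int: "integrable M (\<lambda>w. expQ B (rate j w))"
    by (rule integrable_const_bound[of _ 1]) (auto simp: expQ_bounds)
  show "(\<lambda>w. expQ B (rate j w)) \<in> borel_measurable (env_algebra M \<xi>)"
    by measurable
  fix C assume C: "C \<in> sets (env_algebra M \<xi>)"
  then have CM [measurable]: "C \<in> sets M" using subalgebra_env by (auto simp: subalgebra_def)
  define P where "P = distr (density M (indicator C)) borel (X (i, j))"
  define Q where "Q = distr (density M (indicator C) \<Otimes>\<^sub>M expm 1) borel (\<lambda>p. snd p / rate j (fst p))"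
  interpret MC: finite_measure "density M (indicator C)"
    by (rule finite_measure_restricted) (rule CM)
  interpret e: prob_space "expm 1" by (rule prob_space_expm) simp
  interpret p: pair_sigma_finite "density M (indicator C)" "expm 1" ..
  have intQ: "integrable M (\<lambda>w. indicator C w * expQ B (rate j w))" if [measurable]: "B \<in> sets borel" for B
    by (rule integrable_const_bound[of _ 1]) (auto simp: expQ_bounds indicator_def)
  have mP: "measure P B = (\<integral>w\<in>C. indicator {w \<in> space M. X (i, j) w \<in> B} w \<partial>M)" if [measurable]: "B \<in> sets borel" for B
  proof -
    have "measure P B = measure (density M (indicator C)) (X (i, j) -` B \<inter> space M)"
      unfolding P_def by (subst measure_distr) auto
    also have "\<dots> = measure M (C \<inter> (X (i, j) -` B \<inter> space M))"
      by (rule measure_restricted) auto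
    also have "C \<inter> (X (i, j) -` B \<inter> space M) = C \<inter> {w \<in> space M. X (i, j) w \<in> B}"
      by auto
    also have "measure M (C \<inter> {w \<in> space M. X (i, j) w \<in> B})
        = (\<integral>w. indicator (C \<inter> {w \<in> space M. X (i, j) w \<in> B}) w \<partial>M)"
      by (simp add: integral_indicator)
    also have "\<dots> = (\<integral>w\<in>C. indicator {w \<in> space M. X (i, j) w \<in> B} w \<partial>M)"
      unfolding set_lebesgue_integral_def by (simp add: indicator_inter_arith)
    finally show ?thesis .
  qed
  have eQ: "emeasure Q B = ennreal (\<integral>w\<in>C. expQ B (rate j w) \<partial>M)" if [measurable]: "B \<in> sets borel" for B
  proof -
    have "emeasure Q B = emeasure (density M (indicator C) \<Otimes>\<^sub>M expm 1)
        ((\<lambda>p. snd p / rate j (fst p)) -` B \<inter> space (density M (indicator C) \<Otimes>\<^sub>M expm 1))"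
      unfolding Q_def by (rule emeasure_distr) measurable
    also have "\<dots> = (\<integral>\<^sup>+w. emeasure (expm 1) (Pair w -` ((\<lambda>p. snd p / rate j (fst p)) -` B
        \<inter> space (density M (indicator C) \<Otimes>\<^sub>M expm 1))) \<partial>density M (indicator C))"
      by (rule e.emeasure_pair_measure_alt) measurable
    also have "\<dots> = (\<integral>\<^sup>+w. ennreal (expQ B (rate j w)) \<partial>density M (indicator C))"
      by (rule nn_integral_cong)
        (simp add: space_pair_measure vimage_def emeasure_expm_eq[symmetric])
    also have "\<dots> = (\<integral>\<^sup>+w. ennreal (indicator C w * expQ B (rate j w)) \<partial>M)"
      by (subst nn_integral_density) (auto intro!: nn_integral_cong split: split_indicator)
    also have "\<dots> = ennreal (\<integral>w. indicator C w * expQ B (rate j w) \<partial>M)"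
      by (rule nn_integral_eq_integral) (use intQ[OF that] in \<open>auto simp: expQ_bounds\<close>)
    finally show ?thesis by (simp add: set_lebesgue_integral_def)
  qed
  have Qpos: "(\<integral>w\<in>C. expQ B (rate j w) \<partial>M) \<ge> 0" for B
    unfolding set_lebesgue_integral_def by (auto intro!: integral_nonneg_AE simp: expQ_bounds)
  have mQ: "measure Q B = (\<integral>w\<in>C. expQ B (rate j w) \<partial>M)" if "B \<in> sets borel" for B
    unfolding measure_def eQ[OF that] using Qpos by simp
  have "finite_borel_measure P"
    unfolding P_def finite_borel_measure_def finite_borel_measure_axioms_def
    by (auto intro!: MC.finite_measure_distr)
  moreover have "finite_borel_measure Q"
    unfolding finite_borel_measure_def finite_borel_measure_axioms_def
  proof
    show "finite_measure Q"
      by (rule finite_measureI) (simp add: Q_def eQ[unfolded Q_def])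
  qed (simp add: Q_def)
  moreover have "cdf P x = cdf Q x" if "x > 0" for x
  proof -
    have "cdf P x = (\<integral>w\<in>C. indicator {w \<in> space M. X (i, j) w \<in> {..x}} w \<partial>M)"
      by (simp add: cdf_def mP)
    also have "\<dots> = (\<integral>w\<in>C. real_cond_exp M (env_algebra M \<xi>) (indicator {w \<in> space M. X (i, j) w \<in> {..x}}) w \<partial>M)"
      by (rule cond.real_cond_exp_intA) (auto simp: C emeasure_eq_measure intro!: integrable_real_indicator)
    also have "\<dots> = (\<integral>w\<in>C. expQ {..x} (rate j w) \<partial>M)"
      unfolding set_lebesgue_integral_def
    proof (rule integral_cong_AE)
      have "AE w in M. cond_prob_given M (env_algebra M \<xi>) {w \<in> space M. X (i, j) w \<le> x} w = exp_cdf (\<xi> j w) x"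
        using X \<open>x > 0\<close> by (simp add: exp_weights_given_def)
      then show "AE w in M. indicat_real C w *\<^sub>R
            real_cond_exp M (env_algebra M \<xi>) (indicator {w \<in> space M. X (i, j) w \<in> {..x}}) w
          = indicat_real C w *\<^sub>R expQ {..x} (rate j w)"
        using rate_eq_\<xi>[OF lower, of j]
      proof eventually_elim
        case (elim w)
        have "rate j w > 0" using rate_ge[of j w] c_pos by simp
        then show ?case
          using elim \<open>x > 0\<close> by (simp add: cond_prob_given_def expQ_atMost)
      qed
    qed measurable
    also have "\<dots> = cdf Q x"
      by (simp add: cdf_def mQ)
    finally show ?thesis .
  qed
  moreover have "cdf Q 0 = 0"
  proof -
    have "expQ {..0} (rate j w) = 0" for w
      using rate_ge[of j w] c_pos by (subst expQ_atMost) auto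
    then show ?thesis by (simp add: cdf_def mQ)
  qed
  ultimately have "P = Q" by (rule cdf_eqI_pos)
  then show "(\<integral>w\<in>C. indicator {w \<in> space M. X (i, j) w \<in> B} w \<partial>M) = (\<integral>w\<in>C. expQ B (rate j w) \<partial>M)"
    using mP[OF B] mQ[OF B] by simp
qed

text \<open>Only the coordinates off the axes are used; those on the axes stay free for the boundary
  weights, independent of the bulk given the rates.\<close>

definition env_weights :: "'a \<times> (nat \<times> nat \<Rightarrow> real) \<Rightarrow> nat \<times> nat \<Rightarrow> real" where
  "env_weights u = (\<lambda>(i, j). snd u (Suc i, Suc j) / rate j (fst u))"

lemma measurable_env_weights [measurable (raw)]: "(\<lambda>u. env_weights u z) \<in> borel_measurable env"
  unfolding env_weights_def by (cases z) simp

text \<open>Cylinders decide. On the given space conditional independence and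
  \<open>cond_prob_single\<close> yield the mean of a product of \<open>expQ\<close> terms; on the
  product space Fubini yields the same.\<close>

lemma distr_env_weights:
  assumes lower: "AE r in m. c \<le> r" and X: "exp_weights_given M \<xi> X"
  shows "distr M (Pi\<^sub>M UNIV (\<lambda>_. borel)) (\<lambda>w z. X z w) = distr env (Pi\<^sub>M UNIV (\<lambda>_. borel)) env_weights"
    (is "?P = ?Q")
proof (rule measure_eqI_PiM_infinite[where I = UNIV and M = "\<lambda>_. borel"])
  have mX [measurable]: "X z \<in> borel_measurable M" for z
    using X unfolding exp_weights_given_def by blast
  have m1: "(\<lambda>w z. X z w) \<in> M \<rightarrow>\<^sub>M Pi\<^sub>M UNIV (\<lambda>_. borel)"
    by (rule measurable_PiM_single') (auto simp: space_PiM)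
  have m2: "env_weights \<in> env \<rightarrow>\<^sub>M Pi\<^sub>M UNIV (\<lambda>_. borel)"
    by (rule measurable_PiM_single') (auto simp: space_PiM)
  show "finite_measure ?P"
    by (rule finite_measure_distr) (rule m1)
  fix J :: "(nat \<times> nat) set" and B :: "nat \<times> nat \<Rightarrow> real set"
  assume J: "finite J" and B': "\<And>z. z \<in> J \<Longrightarrow> B z \<in> sets borel"
  let ?S = "{x :: nat \<times> nat \<Rightarrow> real. \<forall>z\<in>J. x z \<in> B z}"
  have emb: "prod_emb UNIV (\<lambda>_. borel) J (Pi\<^sub>E J B) = ?S"
    by (auto simp: prod_emb_def space_PiM restrict_def PiE_iff)
  have S: "?S \<in> sets (Pi\<^sub>M UNIV (\<lambda>_. borel))"
    unfolding emb[symmetric] by (rule sets_PiM_I) (use J B' in auto)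
  have int: "integrable M (\<lambda>w. \<Prod>z\<in>J. expQ (B z) (rate (snd z) w))"
    by (rule integrable_const_bound[of _ 1])
      (use B' in \<open>auto simp: abs_prod expQ_bounds intro!: prod_le_1 borel_measurable_prod\<close>)
  have "emeasure ?P ?S = ennreal (\<integral>w. (\<Prod>z\<in>J. expQ (B z) (rate (snd z) w)) \<partial>M)"
  proof (cases "J = {}")
    \<comment> \<open>\<open>cond_indep_family\<close> speaks of nonempty index sets only, so the
      trivial cylinder is computed directly.\<close>
    case True
    have "space ?P = ?S"
      using True by (simp add: space_PiM)
    then have "emeasure ?P ?S = 1"
      using prob_space.emeasure_space_1[OF prob_space_distr[OF m1]] by metis
    also have "\<dots> = ennreal (\<integral>w. (\<Prod>z\<in>J. expQ (B z) (rate (snd z) w)) \<partial>M)"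
      using True prob_space by simp
    finally show ?thesis .
  next
    case False
    let ?A = "{w \<in> space M. \<forall>z\<in>J. X z w \<in> B z}"
    have A: "?A \<in> sets M" using J B' by measurable
    have "emeasure ?P ?S = emeasure M ?A"
      by (subst emeasure_distr[OF m1 S]) (auto intro!: arg_cong[where f = "emeasure M"])
    also have "\<dots> = ennreal (\<integral>w. indicator ?A w \<partial>M)"
      using A by (simp add: emeasure_eq_measure)
    also have "(\<integral>w. indicator ?A w \<partial>M :: real) = (\<integral>w. cond_prob_given M (env_algebra M \<xi>) ?A w \<partial>M)"
      unfolding cond_prob_given_def
      by (rule cond.real_cond_exp_int(2)[symmetric])
        (use A in \<open>auto intro!: integrable_real_indicator simp: emeasure_eq_measure\<close>)
    also have "\<dots> = (\<integral>w. (\<Prod>z\<in>J. expQ (B z) (rate (snd z) w)) \<partial>M)"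
    proof (rule integral_cong_AE)
      have 1: "AE w in M. \<forall>z\<in>J. cond_prob_given M (env_algebra M \<xi>) {w \<in> space M. X z w \<in> B z} w
          = expQ (B z) (rate (snd z) w)"
      proof (rule AE_finite_allI[OF J])
        fix z assume "z \<in> J"
        then show "AE w in M. cond_prob_given M (env_algebra M \<xi>) {w \<in> space M. X z w \<in> B z} w
          = expQ (B z) (rate (snd z) w)"
          using cond_prob_single[OF lower X B', of z "fst z" "snd z"] by simp
      qed
      have 2: "AE w in M. cond_prob_given M (env_algebra M \<xi>) ?A w
           = (\<Prod>z\<in>J. cond_prob_given M (env_algebra M \<xi>) {w \<in> space M. X z w \<in> B z} w)"
      proof -
        have "cond_indep_family M (env_algebra M \<xi>) X"
          using X unfolding exp_weights_given_def by blast
        from this[unfolded cond_indep_family_def, THEN spec, THEN spec, THEN mp, OF J, THEN mp, OF False, of B]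
        show ?thesis using B' by blast
      qed
      show "AE w in M. cond_prob_given M (env_algebra M \<xi>) ?A w = (\<Prod>z\<in>J. expQ (B z) (rate (snd z) w))"
        using 1 2
      proof eventually_elim
        case (elim w)
        then show ?case by (simp only:) (rule prod.cong, simp_all)
      qed
      show "(\<lambda>w. cond_prob_given M (env_algebra M \<xi>) ?A w) \<in> borel_measurable M"
        unfolding cond_prob_given_def by measurable
    qed (use int in auto)
    finally show ?thesis .
  qed
  also have "\<dots> = (\<integral>\<^sup>+w. ennreal (\<Prod>z\<in>J. expQ (B z) (rate (snd z) w)) \<partial>M)"
    by (rule nn_integral_eq_integral[symmetric, OF int]) (auto intro!: prod_nonneg simp: expQ_bounds)
  also have "\<dots> = (\<integral>\<^sup>+w. emeasure expE (Pair w -` (env_weights -` ?S \<inter> space (M \<Otimes>\<^sub>M expE))) \<partial>M)"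
  proof (rule nn_integral_cong)
    fix w assume w: "w \<in> space M"
    define s where "s = (\<lambda>z::nat \<times> nat. (Suc (fst z), Suc (snd z)))"
    have s: "inj_on s J" by (auto simp: s_def inj_on_def prod_eq_iff)
    define B2 where "B2 = (\<lambda>z. {e. e / rate (snd z - 1) w \<in> B (fst z - 1, snd z - 1)})"
    have B2: "B2 z \<in> sets borel" if "z \<in> s ` J" for z
    proof -
      have [measurable]: "B (fst z - 1, snd z - 1) \<in> sets borel"
        using that B' by (auto simp: s_def)
      show ?thesis unfolding B2_def by measurable
    qed
    have "Pair w -` (env_weights -` ?S \<inter> space (M \<Otimes>\<^sub>M expE)) = {\<omega>. \<forall>z\<in>s ` J. \<omega> z \<in> B2 z}"
      using w by (auto simp: env_weights_def s_def B2_def space_pair_measure)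
    then have "emeasure expE (Pair w -` (env_weights -` ?S \<inter> space (M \<Otimes>\<^sub>M expE)))
        = (\<Prod>z\<in>s ` J. emeasure (expm 1) (B2 z))"
      using emeasure_expE_cylinder[of "s ` J" B2] J B2 by simp
    also have "\<dots> = (\<Prod>z\<in>J. emeasure (expm 1) (B2 (s z)))"
      by (subst prod.reindex[OF s]) simp
    also have "\<dots> = (\<Prod>z\<in>J. ennreal (expQ (B z) (rate (snd z) w)))"
      by (intro prod.cong refl) (simp add: B2_def s_def emeasure_expm_eq)
    also have "\<dots> = ennreal (\<Prod>z\<in>J. expQ (B z) (rate (snd z) w))"
      by (rule prod_ennreal) (simp add: expQ_bounds)
    finally show "ennreal (\<Prod>z\<in>J. expQ (B z) (rate (snd z) w)) =
        emeasure expE (Pair w -` (env_weights -` ?S \<inter> space (M \<Otimes>\<^sub>M expE)))" by simp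
  qed
  also have "\<dots> = emeasure (M \<Otimes>\<^sub>M expE) (env_weights -` ?S \<inter> space (M \<Otimes>\<^sub>M expE))"
    by (rule E.emeasure_pair_measure_alt[symmetric])
      (use measurable_sets[OF m2 S] in \<open>simp add: env_def\<close>)
  also have "\<dots> = emeasure ?Q ?S"
    by (subst emeasure_distr[OF m2 S]) (simp add: env_def)
  finally show "emeasure ?P (prod_emb UNIV (\<lambda>_. borel) J (Pi\<^sub>E J B))
      = emeasure ?Q (prod_emb UNIV (\<lambda>_. borel) J (Pi\<^sub>E J B))"
    unfolding emb .
qed simp_all

text \<open>Each rescaled passage time is one measurable functional of the weights, so equality of
  laws carries the limit, weakened to convergence in probability, to the product space.\<close>

lemma plim_last_passage:
  assumes lower: "AE r in m. c \<le> r" and X: "exp_weights_given M \<xi> X"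
    and \<Psi>: "is_limit_shape M X \<Psi>" and "x > 0" "y > 0"
  shows "plim env (\<lambda>n u. last_passage (env_weights u) (nat \<lfloor>real n * x\<rfloor>) (nat \<lfloor>real n * y\<rfloor>) / real n) (\<Psi> x y)"
proof (rule plim_distr_cong)
  have mX [measurable]: "X z \<in> borel_measurable M" for z
    using X unfolding exp_weights_given_def by blast
  have m1: "(\<lambda>w z. X z w) \<in> M \<rightarrow>\<^sub>M Pi\<^sub>M UNIV (\<lambda>_. borel)"
    by (rule measurable_PiM_single') (auto simp: space_PiM)
  have m2: "env_weights \<in> env \<rightarrow>\<^sub>M Pi\<^sub>M UNIV (\<lambda>_. borel)"
    by (rule measurable_PiM_single') (auto simp: space_PiM)
  let ?T = "\<lambda>n v. last_passage v (nat \<lfloor>real n * x\<rfloor>) (nat \<lfloor>real n * y\<rfloor>) / real n"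
  have T: "?T n \<in> borel_measurable (Pi\<^sub>M UNIV (\<lambda>_. borel))" for n
    by (intro borel_measurable_divide measurable_last_passage measurable_component_singleton) auto
  show "plim M (\<lambda>n w. ?T n (\<lambda>z. X z w)) (\<Psi> x y)"
  proof (rule plim_AE)
    show "(\<lambda>w. ?T n (\<lambda>z. X z w)) \<in> borel_measurable M" for n
      by (rule measurable_compose[OF m1 T])
    show "AE w in M. (\<lambda>n. ?T n (\<lambda>z. X z w)) \<longlonglongrightarrow> \<Psi> x y"
      using \<Psi> \<open>x > 0\<close> \<open>y > 0\<close> by (simp add: is_limit_shape_def)
  qed
  show "(\<lambda>u. ?T n (env_weights u)) \<in> borel_measurable env" for n
    by (rule measurable_compose[OF m2 T])
  show "distr env borel (\<lambda>u. ?T n (env_weights u)) = distr M borel (\<lambda>w. ?T n (\<lambda>z. X z w))" for n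
    using distr_distr[OF T m1] distr_distr[OF T m2] distr_env_weights[OF lower X]
    by (simp add: comp_def)
qed

end

section \<open>The variational formula\<close>

lemma floor_ratio_tendsto:
  assumes "x \<ge> 0"
  shows "(\<lambda>n. real (nat \<lfloor>real n * x\<rfloor>) / real n) \<longlonglongrightarrow> x"
    and "(\<lambda>n. real (Suc (nat \<lfloor>real n * x\<rfloor>)) / real n) \<longlonglongrightarrow> x"
proof -
  have floor: "real n * x - 1 \<le> real (nat \<lfloor>real n * x\<rfloor>)" "real (nat \<lfloor>real n * x\<rfloor>) \<le> real n * x" for n
  proof -
    have "real n * x \<ge> 0" using assms by simp
    then show "real n * x - 1 \<le> real (nat \<lfloor>real n * x\<rfloor>)" "real (nat \<lfloor>real n * x\<rfloor>) \<le> real n * x"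
      by linarith+
  qed
  have "(\<lambda>n. x - 1 / real n) \<longlonglongrightarrow> x - 0"
    by (intro tendsto_diff tendsto_const lim_1_over_n)
  then have lower: "(\<lambda>n. x - 1 / real n) \<longlonglongrightarrow> x" by simp
  show *: "(\<lambda>n. real (nat \<lfloor>real n * x\<rfloor>) / real n) \<longlonglongrightarrow> x"
  proof (rule tendsto_sandwich[OF _ _ lower tendsto_const])
    show "eventually (\<lambda>n. x - 1 / real n \<le> real (nat \<lfloor>real n * x\<rfloor>) / real n) sequentially"
      using eventually_gt_at_top[of 0]
    proof eventually_elim
      case (elim n)
      then show ?case using divide_right_mono[OF floor(1)[of n], of "real n"] by (simp add: diff_divide_distrib)
    qed
    show "eventually (\<lambda>n. real (nat \<lfloor>real n * x\<rfloor>) / real n \<le> x) sequentially"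
      using eventually_gt_at_top[of 0]
    proof eventually_elim
      case (elim n)
      then show ?case using divide_right_mono[OF floor(2)[of n], of "real n"] by simp
    qed
  qed
  have "(\<lambda>n. real (nat \<lfloor>real n * x\<rfloor>) / real n + 1 / real n) \<longlonglongrightarrow> x + 0"
    by (intro tendsto_add * lim_1_over_n)
  then show "(\<lambda>n. real (Suc (nat \<lfloor>real n * x\<rfloor>)) / real n) \<longlonglongrightarrow> x"
    by (simp add: add_divide_distrib add.commute)
qed

context random_rates
begin

lemma env_weights_nonneg:
  assumes "\<forall>a. snd u a \<ge> 0"
  shows "env_weights u z \<ge> 0"
  using assms rate_ge[of "snd z" "fst u"] c_pos by (cases z) (simp add: env_weights_def)

lemma lpp_shift_le_burke:
  assumes nonneg: "\<forall>a. snd u a \<ge> 0" and z: "0 < z" "z < c"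
  shows "lpp (shift_weights (env_weights u)) k l \<le> lpp (burke_weights z (\<lambda>j. rate j (fst u)) (snd u)) k l"
proof (rule lpp_mono)
  fix a :: "nat \<times> nat"
  obtain i j where a: "a = (i, j)" by force
  have "rate j' (fst u) - z \<ge> 0" for j' using rate_ge[of j' "fst u"] z by simp
  then show "shift_weights (env_weights u) a \<le> burke_weights z (\<lambda>j. rate j (fst u)) (snd u) a"
    using nonneg z unfolding a by (cases i; cases j) (auto simp: shift_weights_def env_weights_def)
qed

definition \<phi> :: "real \<Rightarrow> real \<Rightarrow> real" where
  "\<phi> \<alpha> z = \<alpha> / z + \<kappa> z"

context
  fixes X :: "nat \<times> nat \<Rightarrow> 'a \<Rightarrow> real" and \<Psi> :: "real \<Rightarrow> real \<Rightarrow> real"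
  assumes lower: "AE r in m. c \<le> r"
    and X: "exp_weights_given M \<xi> X"
    and \<Psi>: "is_limit_shape M X \<Psi>"
begin

text \<open>Adding the endpoint weight and replacing zero axes by nonnegative weights can only
  increase the passage time, so the bound holds pathwise before the limit.\<close>

lemma limit_shape_le:
  assumes \<alpha>: "\<alpha> > 0" and z: "0 < z" "z < c"
  shows "\<Psi> \<alpha> 1 \<le> \<phi> \<alpha> z"
proof -
  define k where "k n = nat \<lfloor>real n * \<alpha>\<rfloor>" for n
  define l where "l n = nat \<lfloor>real n * 1\<rfloor>" for n
  have T: "plim env (\<lambda>n u. last_passage (env_weights u) (k n) (l n) / real n) (\<Psi> \<alpha> 1)"
    unfolding k_def l_def by (rule plim_last_passage[OF lower X \<Psi>]) (use \<alpha> in auto)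
  have B: "plim env (\<lambda>n u. lpp (burke_weights z (\<lambda>j. rate j (fst u)) (snd u)) (Suc (k n)) (Suc (l n)) / real n)
      (\<alpha> / z + 1 * \<kappa> z)"
    unfolding k_def l_def by (rule plim_burke_lpp[OF z]; rule floor_ratio_tendsto) (use \<alpha> in auto)
  have "\<Psi> \<alpha> 1 \<le> \<alpha> / z + 1 * \<kappa> z"
  proof (rule env.plim_le[OF T B])
    fix n
    show "AE u in env. last_passage (env_weights u) (k n) (l n) / real n
        \<le> lpp (burke_weights z (\<lambda>j. rate j (fst u)) (snd u)) (Suc (k n)) (Suc (l n)) / real n"
      using env_nonneg
    proof eventually_elim
      case (elim u)
      have "last_passage (env_weights u) (k n) (l n)
          \<le> lpp (shift_weights (env_weights u)) (Suc (k n)) (Suc (l n))"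
      proof -
        have "last_passage (env_weights u) (k n) (l n) + env_weights u (k n, l n)
            = lpp (shift_weights (env_weights u)) (Suc (k n)) (Suc (l n))"
          by (rule last_passage_eq_lpp) (rule env_weights_nonneg[OF elim])
        moreover have "env_weights u (k n, l n) \<ge> 0"
          by (rule env_weights_nonneg[OF elim])
        ultimately show ?thesis by linarith
      qed
      also have "\<dots> \<le> lpp (burke_weights z (\<lambda>j. rate j (fst u)) (snd u)) (Suc (k n)) (Suc (l n))"
        by (rule lpp_shift_le_burke[OF elim z])
      finally show ?case by (intro divide_right_mono) auto
    qed
  qed
  then show ?thesis by (simp add: \<phi>_def)
qed

text \<open>This is \<open>lpp_exit_split\<close> with both axis lengths equal to the integer part
  of \<delta>n, divided by \<open>n\<close>. Every term has a constant limit: the first two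
  alternatives lose the gain on the respective axis, the third pays for both axis pieces.\<close>

lemma exit_point_bound:
  assumes \<alpha>: "\<alpha> > 0" and z: "0 < z1" "z1 < z" "z < z2" "z2 < c" and \<delta>: "\<delta> > 0"
  shows "\<phi> \<alpha> z \<le> max (\<phi> \<alpha> z1 - (\<delta> / z1 - \<delta> / z))
    (max (\<phi> \<alpha> z2 - (\<delta> * \<kappa> z2 - \<delta> * \<kappa> z)) (\<delta> / z + \<delta> * \<kappa> z + \<Psi> \<alpha> 1))"
proof -
  define k where "k n = nat \<lfloor>real n * \<alpha>\<rfloor>" for n
  define l where "l n = nat \<lfloor>real n * 1\<rfloor>" for n
  define a where "a n = nat \<lfloor>real n * \<delta>\<rfloor>" for n
  let ?w = "\<lambda>z u. burke_weights z (\<lambda>j. rate j (fst u)) (snd u)"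
  let ?lpp = "\<lambda>z n u. lpp (?w z u) (Suc (k n)) (Suc (l n)) / real n"
  let ?R = "\<lambda>z n u. (\<Sum>i<a n. snd u (Suc i, 0) / z) / real n"
  let ?C = "\<lambda>z n u. (\<Sum>j<a n. snd u (0, Suc j) / (rate j (fst u) - z)) / real n"
  let ?T = "\<lambda>n u. last_passage (env_weights u) (k n) (l n) / real n"
  let ?S = "\<lambda>n u. snd u (Suc (k n), Suc (l n)) / c / real n"
  have T: "plim env ?T (\<Psi> \<alpha> 1)"
    unfolding k_def l_def by (rule plim_last_passage[OF lower X \<Psi>]) (use \<alpha> in auto)
  have lpp: "plim env (?lpp y) (\<phi> \<alpha> y)" if "0 < y" "y < c" for y
    using plim_burke_lpp[OF that floor_ratio_tendsto(2)[of \<alpha>] floor_ratio_tendsto(2)[of 1]] \<alpha>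
    by (simp add: k_def l_def \<phi>_def del: lpp.simps)
  have R: "plim env (?R y) (\<delta> / y)" for y
    using plim_row[OF floor_ratio_tendsto(1)[of \<delta>], of y] \<delta> by (simp add: a_def)
  have C: "plim env (?C y) (\<delta> * \<kappa> y)" if "0 < y" "y < c" for y
    using plim_col[OF that floor_ratio_tendsto(1)[of \<delta>]] \<delta> by (simp add: a_def)
  have S: "plim env ?S 0"
    by (rule plim_single_weight)
  have zc: "0 < z" "z < c" "z1 < c" "0 < z2" using z by auto
  have "plim env (\<lambda>n u. max (?lpp z1 n u - (?R z1 n u - ?R z n u))
      (max (?lpp z2 n u - (?C z2 n u - ?C z n u)) (?R z n u + ?C z n u + ?T n u + ?S n u)))
    (max (\<phi> \<alpha> z1 - (\<delta> / z1 - \<delta> / z))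
      (max (\<phi> \<alpha> z2 - (\<delta> * \<kappa> z2 - \<delta> * \<kappa> z)) (\<delta> / z + \<delta> * \<kappa> z + \<Psi> \<alpha> 1 + 0)))"
    using z zc by (intro env.plim_max env.plim_add env.plim_diff lpp R C T S) auto
  then have "\<phi> \<alpha> z \<le> (max (\<phi> \<alpha> z1 - (\<delta> / z1 - \<delta> / z))
      (max (\<phi> \<alpha> z2 - (\<delta> * \<kappa> z2 - \<delta> * \<kappa> z)) (\<delta> / z + \<delta> * \<kappa> z + \<Psi> \<alpha> 1 + 0)))"
  proof (rule env.plim_le[OF lpp[OF zc(1,2)]])
    fix n
    show "AE u in env. ?lpp z n u \<le> max (?lpp z1 n u - (?R z1 n u - ?R z n u))
      (max (?lpp z2 n u - (?C z2 n u - ?C z n u)) (?R z n u + ?C z n u + ?T n u + ?S n u))"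
      using env_nonneg
    proof eventually_elim
      case (elim u)
      have r: "rate j (fst u) \<ge> c" for j by (rule rate_ge)
      have r': "rate j (fst u) > z2" "rate j (fst u) > z" "rate j (fst u) > 0" for j
        using r[of j] z by auto
      have split: "lpp (?w z u) (Suc (k n)) (Suc (l n)) \<le>
        max (lpp (?w z1 u) (Suc (k n)) (Suc (l n)) - (\<Sum>i<a n. ?w z1 u (Suc i, 0) - ?w z u (Suc i, 0)))
         (max (lpp (?w z2 u) (Suc (k n)) (Suc (l n)) - (\<Sum>j<a n. ?w z2 u (0, Suc j) - ?w z u (0, Suc j)))
           ((\<Sum>i<a n. ?w z u (Suc i, 0)) + (\<Sum>j<a n. ?w z u (0, Suc j))
             + lpp (shift_weights (env_weights u)) (Suc (k n)) (Suc (l n))))"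
      proof (rule lpp_exit_split)
        show "?w z u (Suc i, 0) \<le> ?w z1 u (Suc i, 0)" for i
          using elim z by (auto intro!: divide_left_mono)
        show "?w z u (0, Suc j) \<le> ?w z2 u (0, Suc j)" for j
          using elim z r' by (auto intro!: divide_left_mono mult_pos_pos divide_right_mono)
        show "?w z u (i, 0) \<ge> 0" for i
          using elim zc by simp
        show "?w z u (0, j) \<ge> 0" for j
          using elim zc r'(2) by (cases j) (auto simp: less_imp_le)
      qed (simp_all add: shift_weights_def env_weights_def)
      \<comment> \<open>Replacing the rate by its lower bound \<open>c\<close> gives a term whose
        law is the same in every environment, as \<open>plim_single_weight\<close> requires.\<close>
      have "env_weights u (k n, l n) \<le> snd u (Suc (k n), Suc (l n)) / c"
        using elim r[of "l n"] c_pos r'(3)[of "l n"] by (auto simp: env_weights_def intro!: divide_left_mono mult_pos_pos)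
      then have "lpp (shift_weights (env_weights u)) (Suc (k n)) (Suc (l n))
          \<le> last_passage (env_weights u) (k n) (l n) + snd u (Suc (k n), Suc (l n)) / c"
        using last_passage_eq_lpp[of "env_weights u" "k n" "l n"] env_weights_nonneg[OF elim] by (simp del: lpp.simps)
      with split have "lpp (?w z u) (Suc (k n)) (Suc (l n)) \<le>
        max (lpp (?w z1 u) (Suc (k n)) (Suc (l n)) - ((\<Sum>i<a n. snd u (Suc i, 0) / z1) - (\<Sum>i<a n. snd u (Suc i, 0) / z)))
         (max (lpp (?w z2 u) (Suc (k n)) (Suc (l n)) - ((\<Sum>j<a n. snd u (0, Suc j) / (rate j (fst u) - z2))
              - (\<Sum>j<a n. snd u (0, Suc j) / (rate j (fst u) - z))))
           ((\<Sum>i<a n. snd u (Suc i, 0) / z) + (\<Sum>j<a n. snd u (0, Suc j) / (rate j (fst u) - z))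
             + last_passage (env_weights u) (k n) (l n) + snd u (Suc (k n), Suc (l n)) / c))"
        (is "?g \<le> max (?g1 - (?r1 - ?r)) (max (?g2 - (?c2 - ?c)) (?r + ?c + ?t + ?s))")
        by (simp add: sum_subtractf max_def split: if_splits del: lpp.simps)
      then have "?g / real n \<le> max (?g1 - (?r1 - ?r)) (max (?g2 - (?c2 - ?c)) (?r + ?c + ?t + ?s)) / real n"
        by (intro divide_right_mono) auto
      also have "\<dots> = max ((?g1 - (?r1 - ?r)) / real n) (max ((?g2 - (?c2 - ?c)) / real n) ((?r + ?c + ?t + ?s) / real n))"
        by (simp only: max_divide_distrib_right of_nat_0_le_iff if_True)
      finally show ?case
        by (simp only: diff_divide_distrib add_divide_distrib)
    qed
  qed
  then show ?thesis by simp
qed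

end

section \<open>The function \<kappa> through its divided differences\<close>

sublocale m: prob_space m
  by (rule prob_space_m)

lemma integrable_m:
  assumes "f \<in> borel_measurable borel" "\<And>r. \<bar>f r\<bar> \<le> B"
  shows "integrable m (f :: real \<Rightarrow> real)"
  by (rule m.integrable_const_bound[of _ B])
    (use assms in \<open>auto simp: measurable_cong_sets[OF sets_m refl]\<close>)

lemma inverse_clamp_bound:
  assumes "z < c"
  shows "\<bar>1 / (max c r - z)\<bar> \<le> 1 / (c - z)"
  using assms by (auto simp: abs_of_pos intro!: divide_left_mono mult_pos_pos)

lemma integrable_inverse_clamp: "z < c \<Longrightarrow> integrable m (\<lambda>r. 1 / (max c r - z))"
  by (rule integrable_m[where B = "1 / (c - z)"]) (simp_all only: inverse_clamp_bound, measurable)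

text \<open>The divided difference of \<kappa>, as \<open>\<kappa>_diff\<close> shows;
  \<open>Q z z\<close> plays the role of the derivative of \<kappa> at \<open>z\<close>. The exact
  difference formula replaces differentiation under the integral.\<close>

definition Q :: "real \<Rightarrow> real \<Rightarrow> real" where
  "Q z v = (\<integral>r. 1 / ((max c r - z) * (max c r - v)) \<partial>m)"

lemma integrable_Q:
  assumes "z < c" "v < c"
  shows "integrable m (\<lambda>r. 1 / ((max c r - z) * (max c r - v)))"
proof (rule integrable_m[where B = "1 / (c - z) * (1 / (c - v))"])
  fix r
  have "\<bar>1 / (max c r - z)\<bar> * \<bar>1 / (max c r - v)\<bar> \<le> 1 / (c - z) * (1 / (c - v))"
    using assms by (intro mult_mono inverse_clamp_bound) auto
  then show "\<bar>1 / ((max c r - z) * (max c r - v))\<bar> \<le> 1 / (c - z) * (1 / (c - v))"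
    by (simp add: abs_mult)
qed measurable

lemma Q_commute: "Q z v = Q v z"
  by (simp add: Q_def mult.commute)

lemma Q_pos:
  assumes "z < c"
  shows "Q z z > 0"
  unfolding Q_def
  by (rule m.expectation_greater[OF integrable_Q[OF assms assms]]) (use assms in \<open>auto simp: m.emeasure_space_1\<close>)

lemma \<kappa>_diff:
  assumes "z < c" "v < c"
  shows "\<kappa> v - \<kappa> z = (v - z) * Q z v"
proof -
  have "\<kappa> v - \<kappa> z = (\<integral>r. 1 / (max c r - v) - 1 / (max c r - z) \<partial>m)"
    unfolding \<kappa>_def using assms by (intro Bochner_Integration.integral_diff[symmetric] integrable_inverse_clamp)
  also have "\<dots> = (\<integral>r. (v - z) * (1 / ((max c r - z) * (max c r - v))) \<partial>m)"
  proof (rule Bochner_Integration.integral_cong[OF refl])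
    fix r
    have "max c r - v \<noteq> 0" "max c r - z \<noteq> 0" using assms by auto
    then show "1 / (max c r - v) - 1 / (max c r - z) = (v - z) * (1 / ((max c r - z) * (max c r - v)))"
      by (simp add: field_simps)
  qed
  also have "\<dots> = (v - z) * Q z v"
    unfolding Q_def by (rule integral_mult_right_zero)
  finally show ?thesis .
qed

text \<open>Over a common denominator the integrands differ by \<open>z - z'\<close> divided by
  three factors, each at least \<open>c - d\<close>; hence the cube.\<close>

lemma Q_Lipschitz:
  assumes "z \<le> d" "z' \<le> d" "v \<le> d" "d < c"
  shows "\<bar>Q z v - Q z' v\<bar> \<le> \<bar>z - z'\<bar> / (c - d) ^ 3"
proof -
  have int: "integrable m (\<lambda>r. 1 / ((max c r - z) * (max c r - v)))" "integrable m (\<lambda>r. 1 / ((max c r - z') * (max c r - v)))"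
    using assms by (auto intro: integrable_Q)
  have bd: "\<bar>1 / ((max c r - z) * (max c r - v)) - 1 / ((max c r - z') * (max c r - v))\<bar> \<le> \<bar>z - z'\<bar> / (c - d) ^ 3" for r
  proof -
    define s where "s = max c r"
    have s: "s - z \<ge> c - d" "s - z' \<ge> c - d" "s - v \<ge> c - d" "c - d > 0"
      using assms by (auto simp: s_def)
    then have p: "s - z > 0" "s - z' > 0" "s - v > 0" by linarith+
    then have "1 / ((s - z) * (s - v)) - 1 / ((s - z') * (s - v)) = (z - z') / ((s - z) * (s - z') * (s - v))"
      by (simp add: divide_simps)
    then have "\<bar>1 / ((s - z) * (s - v)) - 1 / ((s - z') * (s - v))\<bar> = \<bar>z - z'\<bar> / ((s - z) * (s - z') * (s - v))"
      using p by (simp add: abs_mult)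
    also have "\<dots> \<le> \<bar>z - z'\<bar> / ((c - d) * (c - d) * (c - d))"
      using s p by (intro divide_left_mono mult_mono mult_pos_pos) auto
    finally show ?thesis by (simp add: s_def power3_eq_cube)
  qed
  have "\<bar>Q z v - Q z' v\<bar> = \<bar>\<integral>r. 1 / ((max c r - z) * (max c r - v)) - 1 / ((max c r - z') * (max c r - v)) \<partial>m\<bar>"
    unfolding Q_def using int by simp
  also have "\<dots> \<le> (\<integral>r. \<bar>1 / ((max c r - z) * (max c r - v)) - 1 / ((max c r - z') * (max c r - v))\<bar> \<partial>m)"
    by (rule integral_abs_bound)
  also have "\<dots> \<le> \<bar>z - z'\<bar> / (c - d) ^ 3"
    using int bd by (intro m.integral_le_const) auto
  finally show ?thesis .
qed

lemma isCont_Q: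
  assumes "0 < z" "z < c"
  shows "isCont (\<lambda>v. Q z v) z"
proof -
  \<comment> \<open>The midpoint keeps \<open>z\<close> and all nearby \<open>v\<close> at distance
    at least \<open>c - d > 0\<close> from the singularity at \<open>c\<close>.\<close>
  define d where "d = (z + c) / 2"
  have d: "z < d" "d < c" using assms by (auto simp: d_def)
  have "((\<lambda>v. Q z v - Q z z) \<longlongrightarrow> 0) (at z)"
  proof (rule Lim_null_comparison)
    have "eventually (\<lambda>v. v < d) (at z)"
      using order_tendstoD(2)[OF tendsto_ident_at d(1)] .
    then show "eventually (\<lambda>v. norm (Q z v - Q z z) \<le> \<bar>v - z\<bar> / (c - d) ^ 3) (at z)"
    proof eventually_elim
      case (elim v)
      then show ?case using Q_Lipschitz[of v d z z] d by (simp add: Q_commute)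
    qed
    have "((\<lambda>v. \<bar>v - z\<bar> / (c - d) ^ 3) \<longlongrightarrow> \<bar>z - z\<bar> / (c - d) ^ 3) (at z)"
      using d by (intro tendsto_intros) auto
    then show "((\<lambda>v. \<bar>v - z\<bar> / (c - d) ^ 3) \<longlongrightarrow> 0) (at z)" by simp
  qed
  then show ?thesis unfolding isCont_def by (simp add: LIM_zero_iff)
qed

text \<open>Prepares the intermediate value theorem for the equation
  \<open>z\<^sup>2 * Q z z = \<alpha>\<close>. Moving one argument at a time and using symmetry
  gives the Lipschitz constant with factor 2.\<close>

lemma continuous_on_Q_diag: "continuous_on {0..c / 2} (\<lambda>z. z\<^sup>2 * Q z z)"
proof -
  have "continuous_on {0..c / 2} (\<lambda>z. Q z z)"
  proof (rule lipschitz_on_continuous_on, rule lipschitz_onI)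
    fix x y assume "x \<in> {0..c / 2}" "y \<in> {0..c / 2}"
    then have "x \<le> c / 2" "y \<le> c / 2" "c / 2 < c" using c_pos by auto
    then have "\<bar>Q x x - Q y x\<bar> \<le> \<bar>x - y\<bar> / (c - c / 2) ^ 3" "\<bar>Q x y - Q y y\<bar> \<le> \<bar>x - y\<bar> / (c - c / 2) ^ 3"
      by - (rule Q_Lipschitz; assumption)+
    then show "dist (Q x x) (Q y y) \<le> 2 / (c - c / 2) ^ 3 * dist x y"
      using Q_commute[of x y] by (simp add: dist_real_def)
  qed (use c_pos in simp)
  then show ?thesis by (intro continuous_intros)
qed

(* The hypothesis on \<alpha> says that the derivative of \<phi> \<alpha> vanishes at z. *)
lemma \<phi>_minimum_le_limit_shape:
  assumes lower: "AE r in m. c \<le> r" and X: "exp_weights_given M \<xi> X" and \<Psi>: "is_limit_shape M X \<Psi>"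
    and z: "0 < z" "z < c" and \<alpha>: "\<alpha> = z\<^sup>2 * Q z z"
  shows "\<phi> \<alpha> z \<le> \<Psi> \<alpha> 1"
proof -
  have "\<alpha> > 0" using z Q_pos[of z] \<alpha> by simp
  have step: "\<phi> \<alpha> z \<le> \<delta> / z + \<delta> * \<kappa> z + \<Psi> \<alpha> 1" if "\<delta> > 0" for \<delta>
  proof -
    have lim: "((\<lambda>v. z * v * Q z v) \<longlongrightarrow> \<alpha>) (at z)"
    proof -
      have "((\<lambda>v. z * v * Q z v) \<longlongrightarrow> z * z * Q z z) (at z)"
        using isCont_Q[OF z] unfolding isCont_def by (intro tendsto_intros)
      then show ?thesis by (simp add: \<alpha> power2_eq_square)
    qed
    \<comment> \<open>The first inequality makes a parameter left of \<open>z\<close> profitable,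
      the second one right of \<open>z\<close>. At \<open>v = z\<close> both are strict because
      \<alpha> is critical there, so by continuity they persist nearby.\<close>
    have near: "eventually (\<lambda>v. \<alpha> - \<delta> < z * v * Q z v \<and> (1 - \<delta>) * (z * v * Q z v) < \<alpha> \<and> 0 < v \<and> v < c) (at z)"
    proof (intro eventually_conj)
      show "eventually (\<lambda>v. \<alpha> - \<delta> < z * v * Q z v) (at z)"
        using order_tendstoD(1)[OF lim, of "\<alpha> - \<delta>"] \<open>\<delta> > 0\<close> by simp
      have "((\<lambda>v. (1 - \<delta>) * (z * v * Q z v)) \<longlongrightarrow> (1 - \<delta>) * \<alpha>) (at z)"
        by (intro tendsto_intros lim)
      moreover have "(1 - \<delta>) * \<alpha> < \<alpha>"
        using \<open>\<delta> > 0\<close> \<open>\<alpha> > 0\<close> by (simp add: algebra_simps)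
      ultimately show "eventually (\<lambda>v. (1 - \<delta>) * (z * v * Q z v) < \<alpha>) (at z)"
        by (rule order_tendstoD(2))
    qed (use order_tendstoD[OF tendsto_ident_at] z in auto)
    obtain l where "l < z" "\<And>v. l < v \<Longrightarrow> v < z \<Longrightarrow> \<alpha> - \<delta> < z * v * Q z v \<and> 0 < v"
      using near unfolding eventually_at_split eventually_at_left_field by blast
    then obtain z1 where z1: "z1 < z" "\<alpha> - \<delta> < z * z1 * Q z z1" "0 < z1"
      using dense[of l z] by blast
    obtain l where "z < l" "\<And>v. z < v \<Longrightarrow> v < l \<Longrightarrow> (1 - \<delta>) * (z * v * Q z v) < \<alpha> \<and> v < c"
      using near unfolding eventually_at_split eventually_at_right_field by blast
    then obtain z2 where z2: "z < z2" "(1 - \<delta>) * (z * z2 * Q z z2) < \<alpha>" "z2 < c"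
      using dense[of z l] by blast
    \<comment> \<open>All differences carry the factor \<open>z - z1\<close>: those of
      \<open>1 / z\<close> by \<open>1 / z1 - 1 / z = (z - z1) / (z * z1)\<close>, that of \<kappa>
      by \<open>\<kappa>_diff\<close>. The sign is then the one arranged in
      \<open>near\<close>.\<close>
    have "\<phi> \<alpha> z1 - (\<delta> / z1 - \<delta> / z) - \<phi> \<alpha> z = (z - z1) / (z * z1) * (\<alpha> - \<delta> - z * z1 * Q z z1)"
    proof -
      have "\<kappa> z1 = \<kappa> z + (z1 - z) * Q z z1" using \<kappa>_diff[of z z1] z z1 by simp
      then show ?thesis
        unfolding \<phi>_def using z z1 by (simp add: divide_simps) (simp add: algebra_simps)
    qed
    also have "\<dots> < 0" using z z1 by (intro mult_pos_neg divide_pos_pos) auto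
    finally have 1: "\<phi> \<alpha> z1 - (\<delta> / z1 - \<delta> / z) < \<phi> \<alpha> z" by simp
    have "\<phi> \<alpha> z2 - (\<delta> * \<kappa> z2 - \<delta> * \<kappa> z) - \<phi> \<alpha> z = (z2 - z) / (z * z2) * ((1 - \<delta>) * (z * z2 * Q z z2) - \<alpha>)"
    proof -
      have "\<kappa> z2 = \<kappa> z + (z2 - z) * Q z z2" using \<kappa>_diff[of z z2] z z2 by simp
      then show ?thesis
        unfolding \<phi>_def using z z2 by (simp add: divide_simps) (simp add: algebra_simps)
    qed
    also have "\<dots> < 0" using z z2 by (intro mult_pos_neg divide_pos_pos) auto
    finally have 2: "\<phi> \<alpha> z2 - (\<delta> * \<kappa> z2 - \<delta> * \<kappa> z) < \<phi> \<alpha> z" by simp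
    \<comment> \<open>The first two alternatives lie strictly below the left-hand side, so only the
      third is possible.\<close>
    show ?thesis
      using exit_point_bound[OF lower X \<Psi> \<open>\<alpha> > 0\<close> z1(3,1) z2(1,3) \<open>\<delta> > 0\<close>] 1 2
      by (simp add: max_def split: if_splits)
  qed
  \<comment> \<open>As \<delta> tends to 0, the contribution of the axes disappears;
    \<open>z1\<close> and \<open>z2\<close> no longer occur in \<open>step\<close>.\<close>
  have "((\<lambda>\<delta>. \<delta> / z + \<delta> * \<kappa> z + \<Psi> \<alpha> 1) \<longlongrightarrow> 0 / z + 0 * \<kappa> z + \<Psi> \<alpha> 1) (at_right 0)"
    using z by (intro tendsto_intros) auto
  then have "\<phi> \<alpha> z \<le> 0 / z + 0 * \<kappa> z + \<Psi> \<alpha> 1"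
    by (rule tendsto_lowerbound[OF _ _ trivial_limit_at_right_real])
      (use step in \<open>auto simp: eventually_at_right_field intro!: exI[of _ 1]\<close>)
  then show ?thesis by simp
qed

section \<open>Expansion for small \<alpha>\<close>

definition \<mu> :: real where
  "\<mu> = (\<integral>r. 1 / max c r \<partial>m)"

definition \<sigma>2 :: real where
  "\<sigma>2 = (\<integral>r. 1 / (max c r)\<^sup>2 \<partial>m)"

lemma \<sigma>2_eq_Q: "\<sigma>2 = Q 0 0"
  by (simp add: \<sigma>2_def Q_def power2_eq_square)

text \<open>Integrates the truncated geometric series 1/(s - z) = 1/s + z/s^2 + z^2/(s^2 (s - z)).
  The remainder is nonnegative, and \<open>z \<le> c / 2\<close> bounds its factor 1/(s - z) by
  \<open>2 / c\<close>.\<close>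

lemma \<kappa>_bounds:
  assumes "0 \<le> z" "z \<le> c / 2"
  shows "\<mu> + z * \<sigma>2 \<le> \<kappa> z" "\<kappa> z \<le> \<mu> + z * \<sigma>2 + z\<^sup>2 * (2 / c) * \<sigma>2"
proof -
  have zc: "z < c" using assms c_pos by simp
  have i1: "integrable m (\<lambda>r. 1 / max c r)"
    using integrable_inverse_clamp[of 0] c_pos by simp
  have i2: "integrable m (\<lambda>r. 1 / (max c r)\<^sup>2)"
    using integrable_Q[of 0 0] c_pos by (simp add: power2_eq_square)
  have i2': "integrable m (\<lambda>r. a * (1 / (max c r)\<^sup>2))" for a
    by (intro integrable_mult_right i2)
  have i3: "integrable m (\<lambda>r. 1 / max c r + z * (1 / (max c r)\<^sup>2))"
    "integrable m (\<lambda>r. 1 / max c r + (z * (1 / (max c r)\<^sup>2) + z\<^sup>2 * (2 / c) * (1 / (max c r)\<^sup>2)))"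
    by (intro Bochner_Integration.integrable_add integrable_mult_right i1 i2)+
  have bounds: "1 / s + z * (1 / s\<^sup>2) \<le> 1 / (s - z)"
    "1 / (s - z) \<le> 1 / s + (z * (1 / s\<^sup>2) + z\<^sup>2 * (2 / c) * (1 / s\<^sup>2))" if "s \<ge> c" for s
  proof -
    have s: "s > 0" "s - z > 0" "s - z \<ge> c / 2" using that assms c_pos by auto
    have eq: "1 / (s - z) = 1 / s + (z * (1 / s\<^sup>2) + z\<^sup>2 * (1 / (s - z)) * (1 / s\<^sup>2))"
      using s by (simp add: divide_simps power2_eq_square) (simp add: algebra_simps)
    have "1 / (s - z) \<le> 2 / c"
      using s c_pos by (simp add: divide_simps)
    then have "z\<^sup>2 * (1 / (s - z)) * (1 / s\<^sup>2) \<le> z\<^sup>2 * (2 / c) * (1 / s\<^sup>2)"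
      by (intro mult_right_mono mult_left_mono) auto
    then show "1 / (s - z) \<le> 1 / s + (z * (1 / s\<^sup>2) + z\<^sup>2 * (2 / c) * (1 / s\<^sup>2))"
      using eq by linarith
    have "z\<^sup>2 * (1 / (s - z)) * (1 / s\<^sup>2) \<ge> 0"
      using s by (intro mult_nonneg_nonneg) auto
    then show "1 / s + z * (1 / s\<^sup>2) \<le> 1 / (s - z)"
      using eq by linarith
  qed
  have "\<mu> + z * \<sigma>2 = (\<integral>r. 1 / max c r + z * (1 / (max c r)\<^sup>2) \<partial>m)"
    unfolding \<mu>_def \<sigma>2_def
    by (simp only: Bochner_Integration.integral_add[OF i1 i2'] integral_mult_right_zero)
  also have "\<dots> \<le> \<kappa> z"
    unfolding \<kappa>_def
    by (rule integral_mono[OF i3(1) integrable_inverse_clamp[OF zc]]) (rule bounds(1), simp)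
  finally show "\<mu> + z * \<sigma>2 \<le> \<kappa> z" .
  have "\<kappa> z \<le> (\<integral>r. 1 / max c r + (z * (1 / (max c r)\<^sup>2) + z\<^sup>2 * (2 / c) * (1 / (max c r)\<^sup>2)) \<partial>m)"
    unfolding \<kappa>_def
    by (rule integral_mono[OF integrable_inverse_clamp[OF zc] i3(2)]) (rule bounds(2), simp)
  also have "\<dots> = \<mu> + z * \<sigma>2 + z\<^sup>2 * (2 / c) * \<sigma>2"
    unfolding \<mu>_def \<sigma>2_def
    by (simp only: Bochner_Integration.integral_add[OF i1 Bochner_Integration.integrable_add[OF i2' i2']]
        Bochner_Integration.integral_add[OF i2' i2'] integral_mult_right_zero add.assoc)
  finally show "\<kappa> z \<le> \<mu> + z * \<sigma>2 + z\<^sup>2 * (2 / c) * \<sigma>2" .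
qed

lemma limit_shape_asymptotics:
  assumes lower: "AE r in m. c \<le> r" and X: "exp_weights_given M \<xi> X" and \<Psi>: "is_limit_shape M X \<Psi>"
  shows "eventually (\<lambda>\<alpha>. norm (\<Psi> \<alpha> 1 - (\<mu> + 2 * sqrt \<sigma>2 * sqrt \<alpha>)) \<le> 2 / c * norm \<alpha>) (at_right 0)"
proof -
  define s where "s = sqrt \<sigma>2"
  have \<sigma>2: "\<sigma>2 > 0" using Q_pos[of 0] c_pos by (simp add: \<sigma>2_eq_Q)
  then have s: "s > 0" "s\<^sup>2 = \<sigma>2" by (auto simp: s_def)
  \<comment> \<open>The first term lets the critical point be found in \<open>{0..c / 2}\<close>,
    the second keeps the test point \<zeta> below \<open>c / 2\<close>.\<close>
  define b where "b = min ((c / 2)\<^sup>2 * Q (c / 2) (c / 2)) ((c / 2 * s)\<^sup>2)"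
  have "b > 0" using Q_pos[of "c / 2"] c_pos s by (simp add: b_def)
  have main: "norm (\<Psi> \<alpha> 1 - (\<mu> + 2 * s * sqrt \<alpha>)) \<le> 2 / c * norm \<alpha>" if \<alpha>: "0 < \<alpha>" "\<alpha> < b" for \<alpha>
  proof -
    have sq: "sqrt \<alpha> > 0" "(sqrt \<alpha>)\<^sup>2 = \<alpha>" using \<alpha> by auto
    \<comment> \<open>The minimiser of \<open>\<alpha> / z + z * \<sigma>2\<close>, where both
      summands equal \<open>s * sqrt \<alpha>\<close>.\<close>
    define \<zeta> where "\<zeta> = sqrt \<alpha> / s"
    have "sqrt \<alpha> \<le> c / 2 * s"
      using \<alpha> s c_pos by (intro real_le_lsqrt) (auto simp: b_def)
    then have \<zeta>: "\<zeta> > 0" "\<zeta> \<le> c / 2"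
      using s sq by (auto simp: \<zeta>_def pos_divide_le_eq)
    have "\<Psi> \<alpha> 1 \<le> \<alpha> / \<zeta> + \<kappa> \<zeta>"
      using limit_shape_le[OF lower X \<Psi> \<alpha>(1) \<zeta>(1)] \<zeta> c_pos by (simp add: \<phi>_def)
    also have "\<dots> \<le> \<alpha> / \<zeta> + (\<mu> + \<zeta> * \<sigma>2 + \<zeta>\<^sup>2 * (2 / c) * \<sigma>2)"
      using \<kappa>_bounds(2)[of \<zeta>] \<zeta> by simp
    also have "\<alpha> / \<zeta> = s * sqrt \<alpha>"
      using sq s by (simp add: \<zeta>_def divide_simps power2_eq_square)
    also have "\<zeta> * \<sigma>2 = s * sqrt \<alpha>"
      using s(1) unfolding s(2)[symmetric] by (simp add: \<zeta>_def power2_eq_square)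
    \<comment> \<open>Since \<open>\<zeta>\<^sup>2 * \<sigma>2 = \<alpha>\<close>, the remainder of
      \<kappa> is exactly the error term, with constant \<open>2 / c\<close>.\<close>
    also have "\<zeta>\<^sup>2 * (2 / c) * \<sigma>2 = 2 / c * \<alpha>"
      using s(1) sq unfolding s(2)[symmetric] by (simp add: \<zeta>_def power_divide)
    finally have upper: "\<Psi> \<alpha> 1 \<le> \<mu> + 2 * s * sqrt \<alpha> + 2 / c * \<alpha>" by simp
    \<comment> \<open>The upper bound may be tested at any point, but the lower bound is available
      only at the critical one, which exists since \<open>z\<^sup>2 * Q z z\<close> runs from 0 to a
      value above \<alpha>.\<close>
    have "\<exists>z\<ge>0. z \<le> c / 2 \<and> z\<^sup>2 * Q z z = \<alpha>"
      by (rule IVT'[where f = "\<lambda>z. z\<^sup>2 * Q z z"])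
        (use \<alpha> c_pos continuous_on_Q_diag in \<open>auto simp: b_def\<close>)
    then obtain z where z: "z \<ge> 0" "z \<le> c / 2" "\<alpha> = z\<^sup>2 * Q z z" by blast
    then have "z > 0" using \<alpha> by (cases "z = 0") auto
    have "2 * s * sqrt \<alpha> \<le> \<alpha> / z + z * \<sigma>2"
    proof -
      \<comment> \<open>The inequality of the two means, written as a square. It holds for every
        positive \<open>z\<close>, so the location of the critical point is immaterial and the lower
        bound has no error term.\<close>
      have "0 \<le> (sqrt \<alpha> - z * s)\<^sup>2 / z" using \<open>z > 0\<close> by simp
      also have "(sqrt \<alpha> - z * s)\<^sup>2 / z = \<alpha> / z + z * \<sigma>2 - 2 * s * sqrt \<alpha>"
        using \<open>z > 0\<close> sq s by (simp add: power2_diff power_mult_distrib diff_divide_distrib add_divide_distrib)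
          (simp add: power2_eq_square)
      finally show ?thesis by simp
    qed
    then have "\<mu> + 2 * s * sqrt \<alpha> \<le> \<alpha> / z + \<kappa> z"
      using \<kappa>_bounds(1)[OF z(1,2)] by simp
    also have "\<dots> \<le> \<Psi> \<alpha> 1"
      using \<phi>_minimum_le_limit_shape[OF lower X \<Psi> \<open>z > 0\<close> _ z(3)] z c_pos by (simp add: \<phi>_def)
    finally show ?thesis
      using upper \<alpha> c_pos by (simp add: abs_le_iff)
  qed
  then show ?thesis
    unfolding eventually_at_right_field s_def[symmetric] using \<open>b > 0\<close> by blast
qed

lemma mu_G_eq: "AE r in m. c \<le> r \<Longrightarrow> mu_G c m = \<mu>"
  unfolding mu_G_def \<mu>_def set_lebesgue_integral_def
  by (rule integral_cong_AE) (auto elim!: eventually_mono simp: measurable_cong_sets[OF sets_m refl])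

lemma sigma_G_eq: "AE r in m. c \<le> r \<Longrightarrow> sigma_G c m = sqrt \<sigma>2"
  unfolding sigma_G_def \<sigma>2_def set_lebesgue_integral_def
  by (rule arg_cong[where f = sqrt], rule integral_cong_AE)
    (auto elim!: eventually_mono simp: measurable_cong_sets[OF sets_m refl])

end

theorem theorem3p2p1:
  fixes M :: "'a measure" and m :: "real measure" and c :: real
    and \<xi> :: "nat \<Rightarrow> 'a \<Rightarrow> real" and X :: "nat \<times> nat \<Rightarrow> 'a \<Rightarrow> real"
    and \<Psi> :: "real \<Rightarrow> real \<Rightarrow> real"
  assumes "prob_space M"
    and "c > 0"
    and "prob_space.indep_vars M (\<lambda>_. borel) \<xi> UNIV"
    and "\<And>j. distr M borel (\<xi> j) = m"
    and "AE r in m. c \<le> r"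
    and "\<And>\<epsilon>. \<epsilon> > 0 \<Longrightarrow> measure m {c..<c + \<epsilon>} > 0"
    and "exp_weights_given M \<xi> X"
    and "is_limit_shape M X \<Psi>"
  shows "(\<lambda>\<alpha>. \<Psi> \<alpha> 1 - (mu_G c m + 2 * sigma_G c m * sqrt \<alpha>)) \<in> O[at_right 0](\<lambda>\<alpha>. \<alpha>)"
proof -
  interpret random_rates M \<xi> m c
    using assms(1-4) by (simp add: random_rates_def random_rates_axioms_def)
  show ?thesis
    unfolding mu_G_eq[OF assms(5)] sigma_G_eq[OF assms(5)]
    by (rule bigoI[OF limit_shape_asymptotics[OF assms(5,7,8)]])
qed

end
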